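(* Let $d\in\mathbb{N}$ and let $M(t)=t\log(e+t)$, $t>0$. There is a constant $c_d$ depending only on $d$ such that for every $f\in L_M(\mathbb{T}^d)$, $$\Big\|(1-\Delta_{\mathbb{T}^d})^{-\frac{d}{4}}M_f(1-\Delta_{\mathbb{T}^d})^{-\frac{d}{4}}\Big\|_{1,\infty}\leq c_d\|f\|_{L_M(\mathbb{T}^d)}.$$
   Context: $\mathbb{T}^d$ is the $d$-dimensional torus, identified with the cube $[-\pi,\pi]^d$ with opposite faces glued, equipped with the normalised Haar measure $m$; $\Delta_{\mathbb{T}^d}$ is the Laplace operator on $L_2(\mathbb{T}^d)$ (so $(1-\Delta_{\mathbb{T}^d})^{s}$ acts on $e^{i\langle n,x\rangle}$, $n\in\mathbb{Z}^d$, by multiplication by $(1+|n|^2)^{s}$). $M_f$ denotes the operator of multiplication by $f$; for unbounded $f$ the operator $(1-\Delta_{\mathbb{T}^d})^{-d/4}M_f(1-\Delta_{\mathbb{T}^d})^{-d/4}$ is understood as the operator on $L_2(\mathbb{T}^d)$ associated with the sesquilinear form $(u,v)\mapsto\int f\,((1-\Delta)^{-d/4}u)\overline{(1-\Delta)^{-d/4}v}\,dm$. For an even convex function $M$ with $M(0)=0$ the Orlicz space $L_M(\Omega,\nu)$ consists of measurable $f$ with $M(\lambda|f|)\in L_1$ for some $\lambda>0$, normed by $\|f\|_{L_M}=\inf\{\lambda>0:\int M(|f|/\lambda)\,d\nu\le 1\}$. For a compact operator $T$, $\mu(k,T)=\inf\{\|T-R\|_\infty:\ \mathrm{rank}(R)\le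 k\}$, and $\|T\|_{p,\infty}=\sup_{k\ge0}(k+1)^{1/p}\mu(k,T)$; $\mathcal{L}_{p,\infty}$ is the set of operators with finite $\|\cdot\|_{p,\infty}$. *)

theory Defs
  imports "HOL-Analysis.Analysis"
begin

text \<open>The torus T^d, realised as the cube [-pi,pi]^d in real^'d (d = CARD('d)),
  with the normalised Haar measure = normalised Lebesgue measure on the cube.\<close>

definition torus_cube :: "(real^'d) set" where
  "torus_cube = {x. \<forall>i. -pi \<le> x$i \<and> x$i \<le> pi}"

definition torus_measure :: "(real^'d) measure" where
  "torus_measure = uniform_measure lborel torus_cube"

definition freq_inner :: "('d::finite \<Rightarrow> int) \<Rightarrow> real^'d \<Rightarrow> real" where
  "freq_inner n x = (\<Sum>i\<in>UNIV. real_of_int (n i) * x$i)"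

definition freq_normsq :: "('d::finite \<Rightarrow> int) \<Rightarrow> real" where
  "freq_normsq n = (\<Sum>i\<in>UNIV. (real_of_int (n i))^2)"

definition character :: "('d::finite \<Rightarrow> int) \<Rightarrow> real^'d \<Rightarrow> complex" where
  "character n x = exp (\<i> * complex_of_real (freq_inner n x))"

definition finsupp_coeffs :: "(('d::finite \<Rightarrow> int) \<Rightarrow> complex) set" where
  "finsupp_coeffs = {c. finite {n. c n \<noteq> 0}}"

definition trig_poly :: "(('d::finite \<Rightarrow> int) \<Rightarrow> complex) \<Rightarrow> real^'d \<Rightarrow> complex" where
  "trig_poly c x = (\<Sum>n\<in>{n. c n \<noteq> 0}. c n * character n x)"

text \<open>(1 - Laplacian)^s applied to a trigonometric polynomial:
  multiplies the n-th coefficient by (1+|n|^2)^s.\<close>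

definition bessel_pot :: "real \<Rightarrow> (('d::finite \<Rightarrow> int) \<Rightarrow> complex) \<Rightarrow> real^'d \<Rightarrow> complex" where
  "bessel_pot s c x = (\<Sum>n\<in>{n. c n \<noteq> 0}.
      complex_of_real ((1 + freq_normsq n) powr s) * c n * character n x)"

definition L2_torus :: "(real^'d \<Rightarrow> complex) set" where
  "L2_torus = {u. u \<in> borel_measurable (torus_measure::(real^'d) measure) \<and>
                  integrable (torus_measure::(real^'d) measure) (\<lambda>x. (cmod (u x))^2)}"

definition L2_inner :: "(real^'d \<Rightarrow> complex) \<Rightarrow> (real^'d \<Rightarrow> complex) \<Rightarrow> complex" where
  "L2_inner u v = (LINT x|(torus_measure::(real^'d) measure). u x * cnj (v x))"

definition L2_norm_torus :: "(real^'d \<Rightarrow> complex) \<Rightarrow> real" where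
  "L2_norm_torus u = sqrt (LINT x|(torus_measure::(real^'d) measure). (cmod (u x))^2)"

text \<open>The sesquilinear form of (1-Delta)^{-d/4} M_f (1-Delta)^{-d/4}, evaluated on
  trigonometric polynomials u = trig_poly c, v = trig_poly c'.\<close>

definition sandwich_form ::
  "(real^'d \<Rightarrow> complex) \<Rightarrow> (('d::finite \<Rightarrow> int) \<Rightarrow> complex) \<Rightarrow> (('d \<Rightarrow> int) \<Rightarrow> complex) \<Rightarrow> complex" where
  "sandwich_form f c c' =
     (LINT x|(torus_measure::(real^'d) measure).
        f x * bessel_pot (- real CARD('d) / 4) c x * cnj (bessel_pot (- real CARD('d) / 4) c' x))"

text \<open>Singular values mu(k,T) = inf { ||T - R|| : rank R \<le> k }.  A rank \<le> k operator
  is R u = \<Sum>j<k. <u,a_j> b_j with a_j, b_j in L_2, so <R u, v> = \<Sum>j<k. <u,a_j><b_j,v>.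
  The operator norm of T - R is computed as the supremum of |<(T-R)u,v>| over
  (the dense set of) trigonometric polynomials u, v in the unit ball of L_2.
  Values in ereal (infinite if T is unbounded).\<close>

definition sandwich_sing_val :: "(real^'d \<Rightarrow> complex) \<Rightarrow> nat \<Rightarrow> ereal" where
  "sandwich_sing_val f k =
    (INF ab \<in> {(a, b). \<forall>j<k. a j \<in> (L2_torus::(real^'d \<Rightarrow> complex) set) \<and> b j \<in> L2_torus}.
      (SUP cc \<in> {(c, c'). c \<in> (finsupp_coeffs::(('d \<Rightarrow> int) \<Rightarrow> complex) set) \<and> c' \<in> finsupp_coeffs \<and>
                   L2_norm_torus (trig_poly c) \<le> 1 \<and> L2_norm_torus (trig_poly c') \<le> 1}.
        ereal (cmod (sandwich_form f (fst cc) (snd cc) -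
           (\<Sum>j<k. L2_inner (trig_poly (fst cc)) (fst ab j) * L2_inner (snd ab j) (trig_poly (snd cc)))))))"

definition sandwich_weak_L1_norm :: "(real^'d \<Rightarrow> complex) \<Rightarrow> ereal" where
  "sandwich_weak_L1_norm f = (SUP k. ereal (real k + 1) * sandwich_sing_val f k)"

definition M_LlogL :: "real \<Rightarrow> real" where
  "M_LlogL t = \<bar>t\<bar> * ln (exp 1 + \<bar>t\<bar>)"

definition orlicz_space :: "(real \<Rightarrow> real) \<Rightarrow> 'a measure \<Rightarrow> ('a \<Rightarrow> complex) set" where
  "orlicz_space M \<nu> = {f. f \<in> borel_measurable \<nu> \<and>
      (\<exists>r>0. (\<integral>\<^sup>+ x. ennreal (M (r * cmod (f x))) \<partial>\<nu>) < \<infinity>)}"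

definition orlicz_norm :: "(real \<Rightarrow> real) \<Rightarrow> 'a measure \<Rightarrow> ('a \<Rightarrow> complex) \<Rightarrow> real" where
  "orlicz_norm M \<nu> f = Inf {r. r > 0 \<and> (\<integral>\<^sup>+ x. ennreal (M (cmod (f x) / r)) \<partial>\<nu>) \<le> 1}"

end

theory Submission
  imports Defs
begin

text \<open>Normalise \<open>w = |f| / r\<close> so that \<open>w\<close> has modular at most \<open>1\<close>, and write \<open>\<rho>(n) = (1 + |n|\<^sup>2)\<^bsup>d/2\<^esup>\<close>, so
  that \<open>#{n. \<rho>(n) \<le> s} \<le> 3\<^sup>d s\<close>. The energy of \<open>u\<close> is \<open>\<integral> w |(1 - \<Delta>)\<^bsup>-d/4\<^esup> u|\<^sup>2\<close>.
  An orthonormal system \<open>S\<close> of trigonometric polynomials with frequencies in \<open>{\<rho> > t}\<close> has total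
  energy at most \<open>H + 4 |S| / t\<close>: where \<open>w \<approx> 2\<^sup>j\<close>, the frequencies with \<open>\<rho> \<le> t 2\<^sup>j\<close> contribute a squared
  Hilbert--Schmidt norm of order \<open>\<integral> w j \<approx> \<integral> w log w\<close>, and the higher ones have squared operator norm of
  order \<open>1/t\<close> by Parseval and a geometric series in \<open>j\<close>. Hence there are at most \<open>H t\<close> orthonormal
  high-frequency vectors of energy exceeding \<open>5/t\<close>; removing a maximal such system and the at most
  \<open>3\<^sup>d t\<close> low frequencies leaves a subspace of codimension of order \<open>t\<close> on which the form is of
  order \<open>r/t\<close>.\<close>

section \<open>Characters of the torus\<close>

lemma torus_cube_eq_cbox: "(torus_cube :: (real^'d) set) = cbox (\<chi> i. -pi) (\<chi> i. pi)"
  by (auto simp: torus_cube_def mem_box_cart)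

lemma emeasure_torus_cube: "emeasure lborel (torus_cube :: (real^'d) set) = ennreal ((2 * pi) ^ CARD('d))"
proof -
  have "emeasure lborel (torus_cube :: (real^'d) set) =
      (\<Prod>b\<in>Basis. ((\<chi> i. pi) - (\<chi> i. -pi)) \<bullet> (b :: real^'d))"
    unfolding torus_cube_eq_cbox by (rule emeasure_lborel_cbox) (auto simp: Basis_vec_def inner_axis)
  also have "(\<Prod>b\<in>Basis. ((\<chi> i. pi) - (\<chi> i. -pi)) \<bullet> (b :: real^'d)) = (\<Prod>b\<in>(Basis :: (real^'d) set). 2 * pi)"
    by (intro prod.cong) (auto simp: Basis_vec_def inner_axis)
  finally show ?thesis by simp
qed

lemma sets_torus_measure [simp, measurable_cong]: "sets (torus_measure :: (real^'d) measure) = sets borel"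
  by (simp add: torus_measure_def)

lemma space_torus_measure [simp]: "space (torus_measure :: (real^'d) measure) = UNIV"
  by (simp add: torus_measure_def)

lemma emeasure_torus_UNIV: "emeasure (torus_measure :: (real^'d) measure) UNIV = 1"
  unfolding torus_measure_def
  by (subst emeasure_uniform_measure)
    (simp_all add: emeasure_torus_cube torus_cube_eq_cbox[symmetric] ennreal_divide_self del: power_mult_distrib, simp add: torus_cube_eq_cbox)

lemma finite_measure_torus_measure: "finite_measure (torus_measure :: (real^'d) measure)"
  by (rule finite_measureI) (simp add: emeasure_torus_UNIV)

text \<open>Fubini: \<open>lborel\<close> is the image of the product measure over the basis
  coordinates. This reduces the integral of a character over the cube to one-dimensional
  integrals.\<close>

lemma integral_lborel_prod:
  fixes f :: "'a::euclidean_space \<Rightarrow> real \<Rightarrow> 'b::{real_normed_field,banach,second_countable_topology}"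
  assumes int: "\<And>b. b \<in> Basis \<Longrightarrow> integrable lborel (f b)"
  shows "(\<integral>x. (\<Prod>b\<in>Basis. f b (x \<bullet> b)) \<partial>lborel) = (\<Prod>b\<in>Basis. (\<integral>x. f b x \<partial>lborel))"
proof -
  have [measurable]: "b \<in> Basis \<Longrightarrow> f b \<in> borel_measurable borel" for b
    using int[of b] by auto
  interpret product_sigma_finite "\<lambda>b::'a. lborel :: real measure" by standard
  have "(\<integral>x. (\<Prod>b\<in>Basis. f b (x \<bullet> b)) \<partial>lborel)
      = (\<integral>x. (\<Prod>b\<in>Basis. f b ((\<Sum>c\<in>Basis. x c *\<^sub>R c) \<bullet> b)) \<partial>(\<Pi>\<^sub>M b\<in>(Basis::'a set). lborel))"
    by (subst lborel_eq) (simp add: integral_distr)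
  also have "\<dots> = (\<integral>x. (\<Prod>b\<in>Basis. f b (x b)) \<partial>(\<Pi>\<^sub>M b\<in>(Basis::'a set). lborel))"
    by (intro Bochner_Integration.integral_cong prod.cong refl) simp
  also have "\<dots> = (\<Prod>b\<in>Basis. (\<integral>x. f b x \<partial>lborel))"
    by (rule product_integral_prod) (auto intro: int)
  finally show ?thesis .
qed

lemma prod_Basis_cart: "(\<Prod>b\<in>(Basis :: (real^'d) set). g b) = (\<Prod>i\<in>UNIV. g (axis i 1))"
proof -
  have "(Basis :: (real^'d) set) = range (\<lambda>i. axis i 1)"
    by (auto simp: Basis_vec_def)
  moreover have "inj (\<lambda>i. axis i (1::real) :: real^'d)"
    by (auto simp: inj_def axis_eq_axis)
  ultimately show ?thesis by (metis (no_types, lifting) comp_apply prod.cong prod.reindex)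
qed

lemma character_eq_prod: "character n x = (\<Prod>i\<in>UNIV. cis (real_of_int (n i) * x $ i))"
  by (simp add: character_def freq_inner_def cis_conv_exp sum_distrib_left exp_sum)

text \<open>The antiderivative \<open>cis (m * x) / (\<i> * m)\<close> takes equal values at
  \<open>-pi\<close> and \<open>pi\<close>, because \<open>sin (m * pi) = 0\<close>.\<close>

lemma integral_cis_period:
  assumes "m \<noteq> 0"
  shows "(\<integral>x. indicator {-pi..pi} x *\<^sub>R cis (real_of_int m * x) \<partial>lborel) = 0"
proof -
  define F where "F x = cis (real_of_int m * x) / (\<i> * of_int m)" for x
  have F: "(F has_vector_derivative cis (real_of_int m * x)) (at x within S)" for x S
    unfolding F_def cis_conv_exp
    by (rule derivative_eq_intros has_vector_derivative_real_field refl | simp add: assms complex_eq_iff)+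
  have "(\<integral>x. indicator {-pi..pi} x *\<^sub>R cis (real_of_int m * x) \<partial>lborel) = F pi - F (-pi)"
    by (rule integral_FTC_atLeastAtMost) (auto intro!: F continuous_intros)
  also have "\<dots> = 0"
  proof -
    have "cis (real_of_int m * pi) = cis (- (real_of_int m * pi))"
      by (auto simp: complex_eq_iff sin_zero_iff_int2)
    then show ?thesis by (simp add: F_def)
  qed
  finally show ?thesis .
qed

lemma integral_torus_eq:
  fixes f :: "real^'d \<Rightarrow> complex"
  assumes [measurable]: "f \<in> borel_measurable borel"
  shows "(\<integral>x. f x \<partial>torus_measure) = (\<integral>x. indicator torus_cube x *\<^sub>R f x \<partial>lborel) / (2 * pi) ^ CARD('d)"
proof -
  have cube: "(torus_cube :: (real^'d) set) \<in> sets borel" by (simp add: torus_cube_eq_cbox)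
  have [measurable]: "Measurable.pred borel (\<lambda>x::real^'d. x \<in> torus_cube)" using cube by simp
  have eq: "torus_measure = density lborel (\<lambda>x. ennreal (indicator (torus_cube :: (real^'d) set) x / (2 * pi) ^ CARD('d)))"
    unfolding torus_measure_def uniform_measure_def emeasure_torus_cube
    by (intro arg_cong[where f = "density lborel"] ext)
      (simp add: divide_ennreal[of 1, simplified] split: split_indicator del: power_mult_distrib)
  have "(\<integral>x. f x \<partial>torus_measure) = (\<integral>x. (indicator torus_cube x / (2 * pi) ^ CARD('d)) *\<^sub>R f x \<partial>lborel)"
    by (subst eq, subst integral_density) auto
  also have "\<dots> = (\<integral>x. (indicator torus_cube x *\<^sub>R f x) / (2 * pi) ^ CARD('d) \<partial>lborel)"
    by (intro Bochner_Integration.integral_cong) (auto simp: scaleR_conv_of_real)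
  finally show ?thesis by simp
qed

lemma character_measurable [measurable]: "character n \<in> borel_measurable borel"
  unfolding character_def freq_inner_def by measurable

lemma borel_measurable_cnj [measurable (raw)]:
  "f \<in> borel_measurable M \<Longrightarrow> (\<lambda>x. cnj (f x)) \<in> borel_measurable M"
  by (rule borel_measurable_continuous_on[of cnj]) (auto intro: continuous_intros)

lemma norm_character [simp]: "cmod (character n x) = 1"
  by (simp add: character_def)

text \<open>A character times the indicator of the cube factorises over the coordinates. A
  coordinate with \<open>n i \<noteq> 0\<close> contributes a full-period integral, which vanishes
  and kills the product.\<close>

lemma integral_character:
  "(\<integral>x. character n x \<partial>(torus_measure :: (real^'d) measure)) = (if n = (\<lambda>_. 0) then 1 else 0)"
proof (cases "n = (\<lambda>_. 0)")
  case True
  show ?thesis using True by (simp add: character_def freq_inner_def measure_def emeasure_torus_UNIV)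
next
  case False
  then obtain i where i: "n i \<noteq> 0" by auto
  define g :: "int \<Rightarrow> real \<Rightarrow> complex" where "g m x = indicator {-pi..pi} x *\<^sub>R cis (real_of_int m * x)" for m x
  have int: "integrable lborel (g m)" for m
    unfolding g_def by (rule borel_integrable_compact) (auto intro!: continuous_intros)
  have "indicator torus_cube x *\<^sub>R character n x = (\<Prod>i\<in>UNIV. g (n i) (x $ i))" for x :: "real^'d"
  proof (cases "x \<in> torus_cube")
    case True
    then show ?thesis by (simp add: character_eq_prod g_def torus_cube_def)
  next
    case False
    then obtain i where "\<not> (-pi \<le> x $ i \<and> x $ i \<le> pi)" by (auto simp: torus_cube_def)
    then have "g (n i) (x $ i) = 0" by (auto simp: g_def)
    then have "(\<Prod>i\<in>UNIV. g (n i) (x $ i)) = 0" by (intro prod_zero) auto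
    then show ?thesis using False by simp
  qed
  \<comment> \<open>Fubini is stated over basis vectors, so the definite description recovers the
    coordinate index from the basis vector.\<close>
  moreover have "(\<Prod>i\<in>UNIV. g (n i) (x $ i)) =
      (\<Prod>b\<in>Basis. (\<lambda>b. g (n (THE i. b = axis i 1))) b (x \<bullet> b))" for x :: "real^'d"
    by (simp add: prod_Basis_cart axis_eq_axis inner_axis)
  ultimately have "(\<integral>x. indicator torus_cube x *\<^sub>R character n x \<partial>lborel)
     = (\<Prod>b\<in>Basis. (\<integral>x. g (n (THE i. (b :: real^'d) = axis i 1)) x \<partial>lborel))"
    by (simp only:) (rule integral_lborel_prod, rule int)
  also have "\<dots> = (\<Prod>i\<in>UNIV. (\<integral>x. g (n i) x \<partial>lborel))"
    by (simp add: prod_Basis_cart axis_eq_axis)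
  also have "\<dots> = 0"
    using integral_cis_period[OF i] by (intro prod_zero) (auto simp: g_def)
  finally show ?thesis
    using False by (simp add: integral_torus_eq)
qed

lemma character_mult_cnj: "character n x * cnj (character m x) = character (\<lambda>i. n i - m i) x"
  by (simp add: character_def freq_inner_def exp_cnj exp_minus[symmetric] exp_add[symmetric]
      sum_subtractf algebra_simps)

lemma integral_character_mult_cnj:
  "(\<integral>x. character n x * cnj (character m x) \<partial>(torus_measure :: (real^'d) measure)) = (if n = m then 1 else 0)"
  by (simp add: character_mult_cnj integral_character fun_eq_iff)

lemma integrable_torus_bounded:
  fixes f :: "real^'d \<Rightarrow> 'b::{banach,second_countable_topology}"
  assumes "f \<in> borel_measurable borel" "\<And>x. norm (f x) \<le> B"
  shows "integrable torus_measure f"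
proof -
  interpret finite_measure "torus_measure :: (real^'d) measure" by (rule finite_measure_torus_measure)
  show ?thesis using assms by (intro integrable_const_bound[of _ B]) (auto simp: measurable_cong_sets[OF sets_torus_measure])
qed

lemma integral_character_sums:
  assumes F: "finite F" and G: "finite G"
  shows "(\<integral>x. (\<Sum>n\<in>F. a n * character n x) * cnj (\<Sum>m\<in>G. b m * character m x) \<partial>(torus_measure :: (real^'d) measure))
    = (\<Sum>n\<in>F. \<Sum>m\<in>G. a n * cnj (b m) * (if n = m then 1 else 0))"
proof -
  have int: "integrable (torus_measure :: (real^'d) measure) (\<lambda>x. character n x * cnj (character m x))" for n m
    by (rule integrable_torus_bounded[where B=1]) (measurable, simp add: norm_mult)
  have "(\<lambda>x. (\<Sum>n\<in>F. a n * character n x) * cnj (\<Sum>m\<in>G. b m * character m x))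
    = (\<lambda>x. \<Sum>n\<in>F. \<Sum>m\<in>G. (a n * cnj (b m)) * (character n x * cnj (character m x)))"
    by (simp add: sum_product fun_eq_iff mult_ac)
  then show ?thesis
    using int by (simp add: Bochner_Integration.integral_sum integral_character_mult_cnj)
qed

lemma parseval_character_sum:
  assumes F: "finite F"
  shows "(\<integral>x. (cmod (\<Sum>n\<in>F. a n * character n x))\<^sup>2 \<partial>(torus_measure :: (real^'d) measure)) = (\<Sum>n\<in>F. (cmod (a n))\<^sup>2)"
proof -
  have "complex_of_real (\<integral>x. (cmod (\<Sum>n\<in>F. a n * character n x))\<^sup>2 \<partial>(torus_measure :: (real^'d) measure))
     = (\<Sum>n\<in>F. \<Sum>m\<in>F. a n * cnj (a m) * (if n = m then 1 else 0))"
    unfolding integral_complex_of_real[symmetric] complex_norm_square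
    by (rule integral_character_sums[OF F F])
  also have "\<dots> = (\<Sum>n\<in>F. a n * cnj (a n))"
    by (intro sum.cong refl) (simp add: F if_distrib sum.delta cong: if_cong)
  also have "\<dots> = complex_of_real (\<Sum>n\<in>F. (cmod (a n))\<^sup>2)"
    by (simp add: complex_norm_square del: of_real_power)
  finally show ?thesis using of_real_eq_iff by blast
qed

section \<open>Finitely supported coefficient vectors\<close>

text \<open>The inner product of square-summable sequences, linear in the first argument. Summing
  over the support of the first argument makes it a finite sum as soon as that one argument is
  finitely supported; symmetry then needs both to be.\<close>

definition coeff_inner :: "('n \<Rightarrow> complex) \<Rightarrow> ('n \<Rightarrow> complex) \<Rightarrow> complex" where
  "coeff_inner c d = (\<Sum>n\<in>{n. c n \<noteq> 0}. c n * cnj (d n))"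

definition coeff_normsq :: "('n \<Rightarrow> complex) \<Rightarrow> real" where
  "coeff_normsq c = (\<Sum>n\<in>{n. c n \<noteq> 0}. (cmod (c n))\<^sup>2)"

definition finsupp :: "('n \<Rightarrow> complex) \<Rightarrow> bool" where
  "finsupp c \<longleftrightarrow> finite {n. c n \<noteq> 0}"

definition coeff_orthonormal :: "('n \<Rightarrow> complex) set \<Rightarrow> bool" where
  "coeff_orthonormal T \<longleftrightarrow> (\<forall>s\<in>T. finsupp s) \<and> (\<forall>s\<in>T. \<forall>s'\<in>T. coeff_inner s s' = (if s = s' then 1 else 0))"

text \<open>For an orthonormal \<open>T\<close> this is the orthogonal projection onto its
  span.\<close>

definition coeff_proj :: "('n \<Rightarrow> complex) set \<Rightarrow> ('n \<Rightarrow> complex) \<Rightarrow> 'n \<Rightarrow> complex" where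
  "coeff_proj T c = (\<lambda>n. \<Sum>s\<in>T. coeff_inner c s * s n)"

lemma coeff_inner_superset:
  assumes "finsupp c" "finite F" "\<And>n. n \<notin> F \<Longrightarrow> c n * cnj (d n) = 0"
  shows "coeff_inner c d = (\<Sum>n\<in>F. c n * cnj (d n))"
  unfolding coeff_inner_def using assms(1,2) assms(3)
  by (intro sum.mono_neutral_cong) (auto simp: finsupp_def)

lemma coeff_normsq_superset:
  assumes "finite F" "\<And>n. n \<notin> F \<Longrightarrow> c n = 0"
  shows "coeff_normsq c = (\<Sum>n\<in>F. (cmod (c n))\<^sup>2)"
  unfolding coeff_normsq_def using assms
  by (intro sum.mono_neutral_left) auto

lemma coeff_normsq_nonneg: "coeff_normsq c \<ge> 0"
  unfolding coeff_normsq_def by (simp add: sum_nonneg)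

lemma coeff_inner_self: "coeff_inner c c = complex_of_real (coeff_normsq c)"
  by (simp add: coeff_inner_def coeff_normsq_def complex_norm_square del: of_real_power)

lemma coeff_normsq_pos: "finsupp c \<Longrightarrow> c n \<noteq> 0 \<Longrightarrow> coeff_normsq c > 0"
  unfolding coeff_normsq_def finsupp_def by (rule sum_pos2[where i = n]) auto

lemma coeff_inner_commute:
  assumes "finsupp c" "finsupp d"
  shows "coeff_inner d c = cnj (coeff_inner c d)"
proof -
  let ?F = "{n. c n \<noteq> 0} \<union> {n. d n \<noteq> 0}"
  have "coeff_inner d c = (\<Sum>n\<in>?F. d n * cnj (c n))" "coeff_inner c d = (\<Sum>n\<in>?F. c n * cnj (d n))"
    using assms by (intro coeff_inner_superset; auto simp: finsupp_def)+
  then show ?thesis by (simp add: mult.commute)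
qed

lemma finsupp_scale [intro]: "finsupp c \<Longrightarrow> finsupp (\<lambda>n. a * c n)"
  unfolding finsupp_def by (rule finite_subset) auto

lemma finsupp_diff [intro]: "finsupp c \<Longrightarrow> finsupp d \<Longrightarrow> finsupp (\<lambda>n. c n - d n)"
  unfolding finsupp_def by (rule finite_subset[of _ "{n. c n \<noteq> 0} \<union> {n. d n \<noteq> 0}"]) auto

lemma finsupp_add [intro]: "finsupp c \<Longrightarrow> finsupp d \<Longrightarrow> finsupp (\<lambda>n. c n + d n)"
  unfolding finsupp_def by (rule finite_subset[of _ "{n. c n \<noteq> 0} \<union> {n. d n \<noteq> 0}"]) auto

lemma finsupp_sum [intro]:
  assumes "finite I" "\<And>i. i \<in> I \<Longrightarrow> finsupp (h i)"
  shows "finsupp (\<lambda>n. \<Sum>i\<in>I. k i * h i n)"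
proof -
  have "{n. (\<Sum>i\<in>I. k i * h i n) \<noteq> 0} \<subseteq> (\<Union>i\<in>I. {n. h i n \<noteq> 0})"
    by (auto elim!: sum.not_neutral_contains_not_neutral)
  then show ?thesis using assms unfolding finsupp_def by (meson finite_UN finite_subset)
qed

lemma finsupp_finite [intro]: "finite F \<Longrightarrow> finsupp (\<lambda>n. if n \<in> F then b n else 0)"
  unfolding finsupp_def by (rule finite_subset[of _ F]) auto

lemma coeff_inner_add_left:
  assumes "finsupp c" "finsupp d"
  shows "coeff_inner (\<lambda>n. c n + d n) e = coeff_inner c e + coeff_inner d e"
proof -
  let ?F = "{n. c n \<noteq> 0} \<union> {n. d n \<noteq> 0}"
  have "coeff_inner c e = (\<Sum>n\<in>?F. c n * cnj (e n))" "coeff_inner d e = (\<Sum>n\<in>?F. d n * cnj (e n))"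
    "coeff_inner (\<lambda>n. c n + d n) e = (\<Sum>n\<in>?F. (c n + d n) * cnj (e n))"
    using assms by (intro coeff_inner_superset; auto simp: finsupp_def dest: finsupp_add[unfolded finsupp_def])+
  then show ?thesis by (simp add: sum.distrib distrib_right)
qed

lemma coeff_inner_scale_left:
  assumes "finsupp c"
  shows "coeff_inner (\<lambda>n. a * c n) e = a * coeff_inner c e"
  by (subst (1 2) coeff_inner_superset[where F = "{n. c n \<noteq> 0}"])
    (use assms in \<open>auto simp: finsupp_def sum_distrib_left mult_ac\<close>)

lemma coeff_inner_diff_left:
  assumes "finsupp c" "finsupp d"
  shows "coeff_inner (\<lambda>n. c n - d n) e = coeff_inner c e - coeff_inner d e"
  using coeff_inner_add_left[OF assms(1) finsupp_scale[OF assms(2)], of "-1" e]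
    coeff_inner_scale_left[OF assms(2), of "-1" e] by simp

lemma coeff_inner_sum_left:
  assumes "finite I" "\<And>i. i \<in> I \<Longrightarrow> finsupp (h i)"
  shows "coeff_inner (\<lambda>n. \<Sum>i\<in>I. k i * h i n) e = (\<Sum>i\<in>I. k i * coeff_inner (h i) e)"
  using assms
proof (induction I rule: finite_induct)
  case empty
  show ?case by (simp add: coeff_inner_def)
next
  case (insert j I)
  then have "coeff_inner (\<lambda>n. k j * h j n + (\<Sum>i\<in>I. k i * h i n)) e
      = coeff_inner (\<lambda>n. k j * h j n) e + coeff_inner (\<lambda>n. \<Sum>i\<in>I. k i * h i n) e"
    by (intro coeff_inner_add_left) auto
  then show ?case using insert by (simp add: coeff_inner_scale_left)
qed

lemma coeff_normsq_scale: "finsupp c \<Longrightarrow> coeff_normsq (\<lambda>n. a * c n) = (cmod a)\<^sup>2 * coeff_normsq c"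
  by (subst (1 2) coeff_normsq_superset[where F = "{n. c n \<noteq> 0}"])
    (auto simp: finsupp_def sum_distrib_left norm_mult power_mult_distrib)

section \<open>Orthogonal projection onto a finite orthonormal system and Bessel's
  inequality\<close>

lemma finsupp_coeff_proj [intro]:
  "finite T \<Longrightarrow> coeff_orthonormal T \<Longrightarrow> finsupp (coeff_proj T c)"
  unfolding coeff_proj_def coeff_orthonormal_def by (intro finsupp_sum) auto

lemma coeff_inner_proj:
  assumes "finite T" "coeff_orthonormal T" "s \<in> T"
  shows "coeff_inner (coeff_proj T c) s = coeff_inner c s"
proof -
  have "coeff_inner (coeff_proj T c) s = (\<Sum>s'\<in>T. coeff_inner c s' * coeff_inner s' s)"
    unfolding coeff_proj_def using assms by (subst coeff_inner_sum_left) (auto simp: coeff_orthonormal_def)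
  also have "\<dots> = (\<Sum>s'\<in>T. if s' = s then coeff_inner c s' else 0)"
    using assms by (intro sum.cong) (auto simp: coeff_orthonormal_def)
  finally show ?thesis using assms by simp
qed

lemma coeff_inner_residual:
  assumes "finite T" "coeff_orthonormal T" "s \<in> T" "finsupp c"
  shows "coeff_inner (\<lambda>n. c n - coeff_proj T c n) s = 0"
  using coeff_inner_proj[OF assms(1-3), of c] assms
  by (subst coeff_inner_diff_left) auto

text \<open>Pythagoras: the residual is orthogonal to every element of \<open>T\<close>, hence to
  the projection, so its inner product with itself equals its inner product with \<open>c\<close>,
  which expands by linearity.\<close>

lemma coeff_normsq_residual:
  assumes T: "finite T" "coeff_orthonormal T" and c: "finsupp c"
  shows "coeff_normsq (\<lambda>n. c n - coeff_proj T c n) = coeff_normsq c - (\<Sum>s\<in>T. (cmod (coeff_inner c s))\<^sup>2)"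
proof -
  let ?r = "\<lambda>n. c n - coeff_proj T c n"
  have fs: "finsupp (coeff_proj T c)" "finsupp ?r" using assms by auto
  have sT: "s \<in> T \<Longrightarrow> finsupp s" for s using T by (auto simp: coeff_orthonormal_def)
  have "coeff_inner (coeff_proj T c) ?r = (\<Sum>s\<in>T. coeff_inner c s * coeff_inner s ?r)"
    using sT T unfolding coeff_proj_def[of T c] by (subst coeff_inner_sum_left) auto
  also have "\<dots> = 0"
    using coeff_inner_residual[OF T _ c] coeff_inner_commute[OF fs(2) sT] by (intro sum.neutral) auto
  finally have "coeff_inner ?r ?r = coeff_inner c ?r"
    using fs c by (subst coeff_inner_diff_left) auto
  also have "\<dots> = cnj (coeff_inner ?r c)" using fs c by (intro coeff_inner_commute) auto
  also have "coeff_inner ?r c = coeff_inner c c - (\<Sum>s\<in>T. coeff_inner c s * coeff_inner s c)"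
    using fs c sT T unfolding coeff_proj_def
    by (subst coeff_inner_diff_left) (auto simp: coeff_inner_sum_left finsupp_sum)
  also have "(\<Sum>s\<in>T. coeff_inner c s * coeff_inner s c) = (\<Sum>s\<in>T. complex_of_real ((cmod (coeff_inner c s))\<^sup>2))"
    by (intro sum.cong refl) (metis c coeff_inner_commute complex_norm_square sT)
  finally have "complex_of_real (coeff_normsq ?r) =
      complex_of_real (coeff_normsq c - (\<Sum>s\<in>T. (cmod (coeff_inner c s))\<^sup>2))"
    by (simp add: coeff_inner_self)
  then show ?thesis using of_real_eq_iff by blast
qed

lemma coeff_bessel:
  assumes "finite T" "coeff_orthonormal T" "finsupp c"
  shows "(\<Sum>s\<in>T. (cmod (coeff_inner c s))\<^sup>2) \<le> coeff_normsq c"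
  using coeff_normsq_residual[OF assms] coeff_normsq_nonneg[of "\<lambda>n. c n - coeff_proj T c n"] by linarith

lemma coeff_cauchy_schwarz:
  assumes F: "finite F"
  shows "cmod (\<Sum>n\<in>F. a n * b n) \<le> sqrt (\<Sum>n\<in>F. (cmod (a n))\<^sup>2) * sqrt (\<Sum>n\<in>F. (cmod (b n))\<^sup>2)"
proof -
  have "cmod (\<Sum>n\<in>F. a n * b n) \<le> (\<Sum>n\<in>F. \<bar>cmod (a n)\<bar> * \<bar>cmod (b n)\<bar>)"
    by (rule order_trans[OF norm_sum]) (simp add: norm_mult)
  also have "\<dots> \<le> L2_set (\<lambda>n. cmod (a n)) F * L2_set (\<lambda>n. cmod (b n)) F"
    by (rule L2_set_mult_ineq)
  finally show ?thesis by (simp add: L2_set_def)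
qed

text \<open>An approximate Riesz representation by a finitely supported vector. The values of the
  functional on unit vectors have square sum at most \<open>K\<^sup>2\<close>; keeping a finite set
  that carries all but \<open>\<epsilon>\<^sup>2\<close> of the supremum leaves an error controlled
  by Cauchy-Schwarz.\<close>

lemma bounded_functional_approx:
  fixes \<psi> :: "('n \<Rightarrow> complex) \<Rightarrow> complex"
  assumes lin: "\<And>(I::'n set) k h. finite I \<Longrightarrow> (\<And>i. i \<in> I \<Longrightarrow> finsupp (h i)) \<Longrightarrow>
        \<psi> (\<lambda>n. \<Sum>i\<in>I. k i * h i n) = (\<Sum>i\<in>I. k i * \<psi> (h i))"
    and bdd: "\<And>c. finsupp c \<Longrightarrow> coeff_normsq c \<le> 1 \<Longrightarrow> cmod (\<psi> c) \<le> K"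
    and \<epsilon>: "\<epsilon> > 0"
  shows "\<exists>a. finsupp a \<and> (\<forall>c. finsupp c \<longrightarrow> coeff_normsq c \<le> 1 \<longrightarrow> cmod (\<psi> c - coeff_inner c a) \<le> \<epsilon>)"
proof -
  define \<delta> :: "'n \<Rightarrow> 'n \<Rightarrow> complex" where "\<delta> m n = (if n = m then 1 else 0)" for m n
  define \<beta> where "\<beta> m = \<psi> (\<delta> m)" for m
  define N where "N F = (\<Sum>n\<in>F. (cmod (\<beta> n))\<^sup>2)" for F
  have fs\<delta>: "finsupp (\<delta> m)" for m by (simp add: finsupp_def \<delta>_def)
  have expand: "\<psi> c = (\<Sum>n\<in>F. c n * \<beta> n)" if "finite F" "\<And>n. n \<notin> F \<Longrightarrow> c n = 0" for c F
  proof -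
    have "c = (\<lambda>n. \<Sum>m\<in>F. c m * \<delta> m n)"
      using that by (auto simp: \<delta>_def fun_eq_iff if_distrib sum.delta' cong: if_cong)
    then have "\<psi> c = \<psi> (\<lambda>n. \<Sum>m\<in>F. c m * \<delta> m n)" by simp
    then show ?thesis using lin[OF that(1), of \<delta> c] fs\<delta> by (simp add: \<beta>_def)
  qed
  have NK: "N F \<le> K\<^sup>2" if F: "finite F" for F
  proof (cases "N F = 0")
    case True
    then show ?thesis by simp
  next
    case False
    then have pos: "N F > 0" unfolding N_def by (simp add: order_less_le sum_nonneg)
    \<comment> \<open>The unit vector for which Cauchy-Schwarz is an equality: the functional takes
      the value \<open>sqrt (N F)\<close> on it.\<close>
    define c where "c n = (if n \<in> F then cnj (\<beta> n) / sqrt (N F) else 0)" for n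
    have c0: "n \<notin> F \<Longrightarrow> c n = 0" for n by (simp add: c_def)
    have "coeff_normsq c = (\<Sum>n\<in>F. (cmod (\<beta> n))\<^sup>2 / N F)"
      using pos by (subst coeff_normsq_superset[OF F c0]) (auto simp: c_def norm_divide power_divide)
    also have "\<dots> = 1" using pos by (simp add: sum_divide_distrib[symmetric] N_def)
    moreover have "finsupp c"
      unfolding finsupp_def by (rule finite_subset[OF _ F]) (auto simp: c_def split: if_splits)
    ultimately have le_K: "cmod (\<psi> c) \<le> K" by (intro bdd) simp_all
    have "\<psi> c = (\<Sum>n\<in>F. c n * \<beta> n)" by (rule expand[OF F]) (rule c0)
    also have "\<dots> = (\<Sum>n\<in>F. complex_of_real ((cmod (\<beta> n))\<^sup>2 / sqrt (N F)))"
      by (intro sum.cong) (auto simp: c_def complex_norm_square mult.commute simp del: of_real_power)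
    also have "\<dots> = complex_of_real (N F / sqrt (N F))" by (simp add: sum_divide_distrib N_def)
    finally have "cmod (\<psi> c) = sqrt (N F)" using pos by (simp add: real_div_sqrt)
    then show ?thesis using le_K by (simp add: sqrt_le_D)
  qed
  define A where "A = N ` {F. finite F}"
  have A: "A \<noteq> {}" "bdd_above A" using NK by (auto simp: A_def intro!: bdd_aboveI[of _ "K\<^sup>2"])
  \<comment> \<open>A nearly maximal \<open>F\<close> exists; any finite set disjoint from it can
    then carry mass at most \<open>\<epsilon>\<^sup>2\<close>.\<close>
  have "\<exists>x\<in>A. Sup A - \<epsilon>\<^sup>2 < x"
    using A \<epsilon> by (subst less_cSup_iff[symmetric]) auto
  then obtain F where F: "finite F" "Sup A - \<epsilon>\<^sup>2 < N F" by (auto simp: A_def)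
  have tail: "N G \<le> \<epsilon>\<^sup>2" if G: "finite G" "G \<inter> F = {}" for G
  proof -
    have "N (G \<union> F) \<le> Sup A" using A G F by (intro cSup_upper) (auto simp: A_def)
    moreover have "N (G \<union> F) = N G + N F" unfolding N_def using G F by (intro sum.union_disjoint) auto
    ultimately show ?thesis using F by linarith
  qed
  define a where "a n = (if n \<in> F then cnj (\<beta> n) else 0)" for n
  have fa: "finsupp a" unfolding a_def using F by auto
  have "cmod (\<psi> c - coeff_inner c a) \<le> \<epsilon>" if c: "finsupp c" "coeff_normsq c \<le> 1" for c
  proof -
    define G where "G = {n. c n \<noteq> 0}"
    have G: "finite G" using c by (simp add: G_def finsupp_def)
    have "\<psi> c = (\<Sum>n\<in>G. c n * \<beta> n)" by (rule expand[OF G]) (simp add: G_def)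
    moreover have "coeff_inner c a = (\<Sum>n\<in>G. c n * (if n \<in> F then \<beta> n else 0))"
      unfolding coeff_inner_def G_def a_def by (intro sum.cong) auto
    ultimately have "\<psi> c - coeff_inner c a = (\<Sum>n\<in>G. c n * (if n \<in> F then 0 else \<beta> n))"
      by (simp add: sum_subtractf[symmetric] if_distrib cong: if_cong)
    also have "\<dots> = (\<Sum>n\<in>G - F. c n * \<beta> n)"
      by (intro sum.mono_neutral_cong_right) (auto simp: G)
    finally have "cmod (\<psi> c - coeff_inner c a) \<le> sqrt (\<Sum>n\<in>G - F. (cmod (c n))\<^sup>2) * sqrt (N (G - F))"
      unfolding N_def using coeff_cauchy_schwarz[of "G - F" c \<beta>] G by simp
    also have "\<dots> \<le> 1 * \<epsilon>"
    proof (intro mult_mono)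
      have "(\<Sum>n\<in>G - F. (cmod (c n))\<^sup>2) \<le> coeff_normsq c"
        unfolding coeff_normsq_def G_def[symmetric] using G by (intro sum_mono2) auto
      then show "sqrt (\<Sum>n\<in>G - F. (cmod (c n))\<^sup>2) \<le> 1" using c by simp
      show "sqrt (N (G - F)) \<le> \<epsilon>" using tail[of "G - F"] G \<epsilon> by (intro real_le_lsqrt) auto
    qed (auto simp: N_def sum_nonneg)
    finally show ?thesis by simp
  qed
  then show ?thesis using fa by blast
qed

section \<open>Counting frequencies\<close>

text \<open>With this exponent the number of frequencies up to level \<open>s\<close> is linear in
  \<open>s\<close>, and the squared multiplier of the Bessel potential of order \<open>-d/4\<close>
  is exactly the reciprocal.\<close>

definition bessel_weight :: "('d::finite \<Rightarrow> int) \<Rightarrow> real" where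
  "bessel_weight n = (1 + freq_normsq n) powr (real CARD('d) / 2)"

lemma freq_normsq_nonneg: "freq_normsq n \<ge> 0"
  by (simp add: freq_normsq_def sum_nonneg)

lemma bessel_weight_ge_1: "bessel_weight n \<ge> 1"
  unfolding bessel_weight_def by (rule ge_one_powr_ge_zero) (auto simp: freq_normsq_nonneg)

lemma bessel_weight_pos [simp]: "bessel_weight n > 0"
  using bessel_weight_ge_1[of n] by linarith

lemma bessel_weight_neq_0 [simp]: "bessel_weight n \<noteq> 0"
  using bessel_weight_pos[of n] by linarith

lemma square_powr_bessel_multiplier:
  "((1 + freq_normsq (n :: 'd::finite \<Rightarrow> int)) powr (- real CARD('d) / 4))\<^sup>2 = 1 / bessel_weight n"
  by (simp add: bessel_weight_def power2_eq_square powr_add[symmetric] powr_minus_divide)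

text \<open>Weight at most \<open>s\<close> forces every \<open>\<bar>n i\<bar>\<close> to be at
  most \<open>s powr (1/d)\<close>, so \<open>n\<close> lies in an integer cube of side
  \<open>2 * m + 1\<close>, which is at most \<open>3 * s powr (1/d)\<close> when
  \<open>s \<ge> 1\<close>. For \<open>s < 1\<close> the set is empty, since all weights are at
  least 1.\<close>

lemma bessel_weight_sublevel:
  fixes s :: real
  shows finite_bessel_weight_le: "finite {n :: 'd::finite \<Rightarrow> int. bessel_weight n \<le> s}"
    and card_bessel_weight_le: "s > 0 \<Longrightarrow> real (card {n :: 'd \<Rightarrow> int. bessel_weight n \<le> s}) \<le> 3 ^ CARD('d) * s"
proof -
  let ?d = "real CARD('d)"
  define S where "S = {n :: 'd \<Rightarrow> int. bessel_weight n \<le> s}"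
  have "finite S \<and> (s > 0 \<longrightarrow> real (card S) \<le> 3 ^ CARD('d) * s)"
  proof (cases "s \<ge> 1")
    case False
    then have "s < bessel_weight n" for n :: "'d \<Rightarrow> int" using bessel_weight_ge_1[of n] by linarith
    then have "S = {}" by (auto simp: S_def not_le)
    then show ?thesis by simp
  next
    case s: True
    define m where "m = \<lfloor>s powr (1 / ?d)\<rfloor>"
    have m1: "m \<ge> 1" using s by (simp add: m_def le_floor_iff ge_one_powr_ge_zero)
    have "S \<subseteq> (\<Pi>\<^sub>E i\<in>UNIV. {-m..m})"
    proof
      fix n assume "n \<in> S"
      then have "(1 + freq_normsq n) powr (?d / 2) \<le> s" by (simp add: S_def bessel_weight_def)
      then have "((1 + freq_normsq n) powr (?d / 2)) powr (2 / ?d) \<le> s powr (2 / ?d)"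
        by (intro powr_mono2) auto
      then have le: "1 + freq_normsq n \<le> (s powr (1 / ?d))\<^sup>2"
        using freq_normsq_nonneg[of n] s by (simp add: powr_powr power2_eq_square powr_add[symmetric])
      have "n i \<in> {-m..m}" for i
      proof -
        have "(real_of_int (n i))\<^sup>2 \<le> freq_normsq n"
          unfolding freq_normsq_def by (rule member_le_sum) auto
        then have "\<bar>real_of_int (n i)\<bar>\<^sup>2 \<le> (s powr (1 / ?d))\<^sup>2"
          using le unfolding power2_abs by linarith
        then have "\<bar>real_of_int (n i)\<bar> \<le> s powr (1 / ?d)"
          by (rule power2_le_imp_le) (rule powr_ge_zero)
        then have "\<bar>n i\<bar> \<le> m" unfolding m_def by (simp add: le_floor_iff)
        then show ?thesis by auto
      qed
      then show "n \<in> (\<Pi>\<^sub>E i\<in>UNIV. {-m..m})" by auto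
    qed
    moreover have fin: "finite (\<Pi>\<^sub>E i\<in>(UNIV::'d set). {-m..m})" by (intro finite_PiE) auto
    moreover have "card (\<Pi>\<^sub>E i\<in>(UNIV::'d set). {-m..m}) = nat (2 * m + 1) ^ CARD('d)"
      using m1 by (simp add: card_PiE algebra_simps)
    ultimately have S: "finite S" "card S \<le> nat (2 * m + 1) ^ CARD('d)"
      by (auto intro: finite_subset) (metis card_mono fin)
    have "real (card S) \<le> real (nat (2 * m + 1) ^ CARD('d))" using S(2) by (rule of_nat_mono)
    also have "\<dots> = (2 * real_of_int m + 1) ^ CARD('d)" using m1 by simp
    also have "\<dots> \<le> (3 * s powr (1 / ?d)) ^ CARD('d)"
    proof (rule power_mono)
      have "real_of_int m \<le> s powr (1 / ?d)" by (simp add: m_def)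
      moreover have "1 \<le> s powr (1 / ?d)" using s by (simp add: ge_one_powr_ge_zero)
      ultimately show "2 * real_of_int m + 1 \<le> 3 * s powr (1 / ?d)" by linarith
    qed (use m1 in auto)
    also have "\<dots> = 3 ^ CARD('d) * s"
      using s by (simp add: power_mult_distrib powr_realpow[symmetric] powr_powr)
    finally show ?thesis using S by simp
  qed
  then show "finite {n :: 'd::finite \<Rightarrow> int. bessel_weight n \<le> s}"
    "s > 0 \<Longrightarrow> real (card {n :: 'd \<Rightarrow> int. bessel_weight n \<le> s}) \<le> 3 ^ CARD('d) * s"
    by (auto simp: S_def)
qed

text \<open>Each of the \<open>j\<close> dyadic shells contributes a constant: the shell above
  \<open>t * 2 ^ j\<close> has at most \<open>3 ^ d * t * 2 ^ Suc j\<close> points, and each summand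
  is at most \<open>1 / (t * 2 ^ j)\<close>.\<close>

lemma sum_inverse_bessel_weight_dyadic:
  assumes t: "t > 0"
  shows "(\<Sum>n | t < bessel_weight (n :: 'd::finite \<Rightarrow> int) \<and> bessel_weight n \<le> t * 2 ^ j. 1 / bessel_weight n)
    \<le> 2 * 3 ^ CARD('d) * real j"
proof (induction j)
  case 0
  have "{n :: 'd \<Rightarrow> int. t < bessel_weight n \<and> bessel_weight n \<le> t * 2 ^ 0} = {}" by auto
  then show ?case by (metis (no_types, lifting) mult_zero_right of_nat_0 order_refl sum.empty)
next
  case (Suc j)
  let ?A = "{n :: 'd \<Rightarrow> int. t < bessel_weight n \<and> bessel_weight n \<le> t * 2 ^ j}"
  let ?B = "{n :: 'd \<Rightarrow> int. t * 2 ^ j < bessel_weight n \<and> bessel_weight n \<le> t * 2 ^ Suc j}"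
  have fin: "finite ?A" "finite ?B"
    by (rule finite_subset[OF _ finite_bessel_weight_le[of "t * 2 ^ j"]], force)
      (rule finite_subset[OF _ finite_bessel_weight_le[of "t * 2 ^ Suc j"]], force)
  have tj: "t \<le> t * 2 ^ j" "t * 2 ^ j \<le> t * 2 ^ Suc j" using t by simp_all
  have "{n :: 'd \<Rightarrow> int. t < bessel_weight n \<and> bessel_weight n \<le> t * 2 ^ Suc j} = ?A \<union> ?B"
    by (intro set_eqI iffI; unfold Un_iff mem_Collect_eq; use tj in linarith)
  moreover have "?A \<inter> ?B = {}" by auto
  ultimately have "(\<Sum>n | t < bessel_weight (n :: 'd \<Rightarrow> int) \<and> bessel_weight n \<le> t * 2 ^ Suc j. 1 / bessel_weight n)
      = (\<Sum>n\<in>?A. 1 / bessel_weight n) + (\<Sum>n\<in>?B. 1 / bessel_weight n)"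
    using fin by (simp add: sum.union_disjoint)
  moreover have "(\<Sum>n\<in>?B. 1 / bessel_weight n) \<le> 2 * 3 ^ CARD('d)"
  proof -
    have "(\<Sum>n\<in>?B. 1 / bessel_weight n) \<le> real (card ?B) * (1 / (t * 2 ^ j))"
      using t by (intro sum_bounded_above divide_left_mono) auto
    also have "\<dots> \<le> (3 ^ CARD('d) * (t * 2 ^ Suc j)) * (1 / (t * 2 ^ j))"
    proof (intro mult_right_mono)
      have "real (card ?B) \<le> real (card {n :: 'd \<Rightarrow> int. bessel_weight n \<le> t * 2 ^ Suc j})"
        by (intro of_nat_mono card_mono finite_bessel_weight_le) auto
      also have "\<dots> \<le> 3 ^ CARD('d) * (t * 2 ^ Suc j)" using t by (intro card_bessel_weight_le) simp
      finally show "real (card ?B) \<le> 3 ^ CARD('d) * (t * 2 ^ Suc j)" .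
    qed (use t in simp)
    also have "\<dots> = 2 * 3 ^ CARD('d)" using t by simp
    finally show ?thesis .
  qed
  ultimately show ?case using Suc by (simp add: algebra_simps)
qed

text \<open>A geometric series is dominated by its last term: if the top term is present, the whole
  sum is below \<open>2 ^ Suc J\<close>, and \<open>2 ^ J < \<rho> / t\<close>.\<close>

lemma sum_dyadic_below:
  assumes "t > 0" "\<rho> > 0"
  shows "(\<Sum>j<J. if t * 2 ^ j < \<rho> then 2 ^ j else (0::real)) \<le> 2 * \<rho> / t"
proof (induction J)
  case 0
  then show ?case using assms by simp
next
  case (Suc J)
  show ?case
  proof (cases "t * 2 ^ J < \<rho>")
    case True
    have "(\<Sum>j<Suc J. if t * 2 ^ j < \<rho> then 2 ^ j else (0::real)) \<le> (\<Sum>j<Suc J. 2 ^ j)"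
      by (intro sum_mono) auto
    also have "\<dots> = 2 ^ Suc J - 1"
      by (induction J) auto
    also have "\<dots> \<le> 2 * \<rho> / t" using True assms by (simp add: field_simps)
    finally show ?thesis .
  next
    case False
    then show ?thesis using Suc by simp
  qed
qed

section \<open>Elementary bounds for the Orlicz function and its dyadic levels\<close>

lemma M_LlogL_nonneg: "M_LlogL t \<ge> 0"
  unfolding M_LlogL_def by (intro mult_nonneg_nonneg ln_ge_zero) (auto intro: add_increasing2)

lemma le_M_LlogL: "t \<le> M_LlogL t"
proof -
  have "1 \<le> ln (exp 1 + \<bar>t\<bar>)"
    by (metis abs_ge_zero exp_gt_zero le_add_same_cancel1 ln_exp ln_mono)
  then have "\<bar>t\<bar> * 1 \<le> M_LlogL t" unfolding M_LlogL_def by (intro mult_left_mono) auto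
  then show ?thesis by linarith
qed

text \<open>The logarithmic factor is increasing, so only the linear factor has to be scaled. This
  turns a finite modular into one that is at most 1.\<close>

lemma M_LlogL_scale_le:
  assumes "0 \<le> s" "s \<le> 1" "t \<ge> 0"
  shows "M_LlogL (s * t) \<le> s * M_LlogL t"
proof -
  have "ln (exp 1 + s * t) \<le> ln (exp 1 + t)"
    using assms by (intro ln_mono) (auto simp: mult_left_le_one_le add_pos_nonneg)
  then have "(s * t) * ln (exp 1 + s * t) \<le> (s * t) * ln (exp 1 + t)"
    using assms by (intro mult_left_mono) auto
  then show ?thesis using assms by (simp add: M_LlogL_def mult.assoc)
qed

text \<open>Take the least \<open>j\<close> with \<open>w \<le> 2 ^ j\<close>. For positive
  \<open>j\<close>, minimality gives \<open>2 ^ (j - 1) < w\<close>, so \<open>j - 1\<close> is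
  bounded by a multiple of the logarithm; for \<open>j = 0\<close> the left side of the second bound
  is zero.\<close>

lemma exists_dyadic_level:
  assumes "w \<ge> 0"
  obtains j :: nat where "w \<le> 2 ^ j" "w * real j \<le> 3 * M_LlogL w"
proof -
  obtain j0 :: nat where "w < 2 ^ j0" using real_arch_pow[of 2 w] by auto
  then have ex: "\<exists>j::nat. w \<le> 2 ^ j" by (intro exI[of _ j0]) simp
  define j where "j = (LEAST j::nat. w \<le> 2 ^ j)"
  have j: "w \<le> 2 ^ j" unfolding j_def by (rule LeastI_ex[OF ex])
  have "w * real j \<le> 3 * M_LlogL w"
  proof (cases j)
    case 0
    then show ?thesis by (simp add: M_LlogL_nonneg)
  next
    case (Suc i)
    then have "\<not> w \<le> 2 ^ i" using not_less_Least[of i "\<lambda>j::nat. w \<le> 2 ^ j"] by (simp add: j_def)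
    then have i: "2 ^ i < w" by simp
    then have w: "w > 0" by (meson less_trans zero_less_numeral zero_less_power)
    let ?l = "ln (exp 1 + w)"
    have l1: "1 \<le> ?l" by (metis assms exp_gt_zero le_add_same_cancel1 ln_exp ln_mono)
    have "real i * ln 2 = ln (2 ^ i)" by (simp add: ln_realpow)
    also have "\<dots> \<le> ?l" using i w by (intro ln_mono) (auto intro: add_increasing)
    finally have "real i * ln 2 \<le> ?l" .
    moreover have "real i * (2 / 3) \<le> real i * ln 2" by (intro mult_left_mono ln2_ge_two_thirds) auto
    \<comment> \<open>Here \<open>i \<le> 3/2 * ?l\<close> and \<open>1 \<le> ?l\<close> give
      \<open>j = i + 1 \<le> 5/2 * ?l\<close>, rounded up to 3.\<close>
    ultimately have "real j \<le> 3 * ?l" using l1 Suc by simp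
    then have "w * real j \<le> w * (3 * ?l)" using assms by (intro mult_left_mono)
    then show ?thesis using assms by (simp add: M_LlogL_def)
  qed
  then show ?thesis using that j by blast
qed

section \<open>Trigonometric polynomials and Bessel potentials\<close>

definition bessel_mult :: "('d::finite \<Rightarrow> int) \<Rightarrow> real" where
  "bessel_mult n = (1 + freq_normsq n) powr (- real CARD('d) / 4)"

definition half_pot :: "(('d::finite \<Rightarrow> int) \<Rightarrow> complex) \<Rightarrow> real^'d \<Rightarrow> complex" where
  "half_pot c x = bessel_pot (- real CARD('d) / 4) c x"

lemma bessel_mult_square: "(bessel_mult n)\<^sup>2 = 1 / bessel_weight n"
  unfolding bessel_mult_def by (rule square_powr_bessel_multiplier)

lemma half_pot_superset:
  assumes "finite F" "\<And>n. n \<notin> F \<Longrightarrow> c n = 0"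
  shows "half_pot c x = (\<Sum>n\<in>F. (of_real (bessel_mult n) * c n) * character n x)"
  unfolding half_pot_def bessel_pot_def bessel_mult_def using assms
  by (intro sum.mono_neutral_left) auto

lemma half_pot_eq: "half_pot c x = (\<Sum>n\<in>{n. c n \<noteq> 0}. (of_real (bessel_mult n) * c n) * character n x)"
  by (simp add: half_pot_def bessel_pot_def bessel_mult_def)

lemma half_pot_measurable [measurable]: "half_pot c \<in> borel_measurable borel"
  unfolding half_pot_eq[abs_def] by measurable

lemma half_pot_bounded: "\<exists>B. \<forall>x. cmod (half_pot c x) \<le> B"
proof (intro exI allI)
  show "cmod (half_pot c x) \<le> (\<Sum>n\<in>{n. c n \<noteq> 0}. cmod (of_real (bessel_mult n) * c n))" for x
    unfolding half_pot_eq by (rule order_trans[OF norm_sum]) (simp add: norm_mult)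
qed

lemma half_pot_diff:
  assumes "finsupp c" "finsupp d"
  shows "half_pot (\<lambda>n. c n - d n) x = half_pot c x - half_pot d x"
proof -
  let ?F = "{n. c n \<noteq> 0} \<union> {n. d n \<noteq> 0}"
  have F: "finite ?F" using assms by (simp add: finsupp_def)
  show ?thesis
    by (subst (1 2 3) half_pot_superset[OF F]) (auto simp: algebra_simps sum_subtractf)
qed

lemma half_pot_sum:
  assumes "finite I" "\<And>i. i \<in> I \<Longrightarrow> finsupp (h i)"
  shows "half_pot (\<lambda>n. \<Sum>i\<in>I. k i * h i n) x = (\<Sum>i\<in>I. k i * half_pot (h i) x)"
proof -
  let ?F = "\<Union>i\<in>I. {n. h i n \<noteq> 0}"
  have F: "finite ?F" using assms by (auto simp: finsupp_def)
  have "half_pot (\<lambda>n. \<Sum>i\<in>I. k i * h i n) x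
      = (\<Sum>n\<in>?F. (of_real (bessel_mult n) * (\<Sum>i\<in>I. k i * h i n)) * character n x)"
    by (rule half_pot_superset[OF F]) (auto intro!: sum.neutral)
  also have "\<dots> = (\<Sum>i\<in>I. k i * (\<Sum>n\<in>?F. (of_real (bessel_mult n) * h i n) * character n x))"
    unfolding sum_distrib_left sum_distrib_right by (subst sum.swap) (simp add: mult_ac)
  also have "\<dots> = (\<Sum>i\<in>I. k i * half_pot (h i) x)"
    by (intro sum.cong refl arg_cong2[where f = "(*)"] half_pot_superset[OF F, symmetric]) auto
  finally show ?thesis .
qed

lemma half_pot_scale: "finsupp c \<Longrightarrow> half_pot (\<lambda>n. a * c n) x = a * half_pot c x"
  using half_pot_sum[of "{()}" "\<lambda>_. c" "\<lambda>_. a" x] by simp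

lemma trig_poly_superset:
  assumes "finite F" "\<And>n. n \<notin> F \<Longrightarrow> c n = 0"
  shows "trig_poly c x = (\<Sum>n\<in>F. c n * character n x)"
  unfolding trig_poly_def using assms by (intro sum.mono_neutral_left) auto

lemma trig_poly_measurable [measurable]: "trig_poly c \<in> borel_measurable borel"
  unfolding trig_poly_def[abs_def] by measurable

lemma trig_poly_in_L2: "trig_poly c \<in> (L2_torus :: (real^'d \<Rightarrow> complex) set)"
proof -
  let ?B = "\<Sum>n\<in>{n. c n \<noteq> 0}. cmod (c n)"
  have "cmod (trig_poly c x) \<le> ?B" for x
    unfolding trig_poly_def by (rule order_trans[OF norm_sum]) (simp add: norm_mult)
  then have "integrable (torus_measure :: (real^'d) measure) (\<lambda>x. (cmod (trig_poly c x))\<^sup>2)"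
    by (intro integrable_torus_bounded[where B = "?B\<^sup>2"]) (measurable, auto intro: power_mono)
  then show ?thesis by (simp add: L2_torus_def measurable_cong_sets[OF sets_torus_measure refl])
qed

text \<open>Orthonormality of the characters. Together with the norm identity below it moves the
  argument from functions on the torus to finitely supported coefficient vectors.\<close>

lemma L2_inner_trig_poly:
  assumes "finsupp c" "finsupp d"
  shows "L2_inner (trig_poly c) (trig_poly d :: real^'d \<Rightarrow> complex) = coeff_inner c d"
proof -
  define F where "F = {n. c n \<noteq> 0} \<union> {n. d n \<noteq> 0}"
  have F: "finite F" using assms by (simp add: F_def finsupp_def)
  have cF: "n \<notin> F \<Longrightarrow> c n = 0" and dF: "n \<notin> F \<Longrightarrow> d n = 0" for n by (auto simp: F_def)
  have "L2_inner (trig_poly c) (trig_poly d :: real^'d \<Rightarrow> complex) = (\<Sum>n\<in>F. \<Sum>m\<in>F. c n * cnj (d m) * (if n = m then 1 else 0))"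
  proof -
    have "trig_poly c x = (\<Sum>n\<in>F. c n * character n x)" "trig_poly d x = (\<Sum>n\<in>F. d n * character n x)" for x
      by (rule trig_poly_superset[OF F], simp add: cF dF)+
    then show ?thesis
      unfolding L2_inner_def by (simp only: integral_character_sums[OF F F])
  qed
  also have "\<dots> = (\<Sum>n\<in>F. c n * cnj (d n))"
    by (intro sum.cong refl) (simp add: F if_distrib cong: if_cong)
  also have "\<dots> = coeff_inner c d"
    by (rule coeff_inner_superset[symmetric]) (use assms F cF in auto)
  finally show ?thesis .
qed

lemma L2_norm_trig_poly:
  assumes "finsupp c"
  shows "L2_norm_torus (trig_poly c :: real^'d \<Rightarrow> complex) = sqrt (coeff_normsq c)"
  unfolding L2_norm_torus_def trig_poly_def coeff_normsq_def
  using assms by (subst parseval_character_sum) (auto simp: finsupp_def)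

text \<open>The infimum defining the singular value is bounded by one explicit competitor. An
  arbitrary finite index set is allowed so that the rank-one terms can later be indexed by two
  copies of an orthonormal system.\<close>

lemma sandwich_sing_val_le:
  fixes f :: "real^'d \<Rightarrow> complex" and A B :: "'i \<Rightarrow> ('d \<Rightarrow> int) \<Rightarrow> complex"
  assumes I: "finite I" "card I \<le> k" "\<And>i. i \<in> I \<Longrightarrow> finsupp (A i)" "\<And>i. i \<in> I \<Longrightarrow> finsupp (B i)"
    and E: "\<And>c c'. finsupp c \<Longrightarrow> finsupp c' \<Longrightarrow> coeff_normsq c \<le> 1 \<Longrightarrow> coeff_normsq c' \<le> 1 \<Longrightarrow>
      cmod (sandwich_form f c c' - (\<Sum>i\<in>I. coeff_inner c (A i) * coeff_inner (B i) c')) \<le> E"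
  shows "sandwich_sing_val f k \<le> ereal E"
proof -
  obtain h where h: "bij_betw h {0..<card I} I" using ex_bij_betw_nat_finite[OF I(1)] by blast
  \<comment> \<open>The terms from \<open>card I\<close> up to \<open>k\<close> are padded with the
    zero function, which lies in \<open>L2_torus\<close> and adds nothing to the sum.\<close>
  define a where "a j = (if j < card I then trig_poly (A (h j)) else (\<lambda>_. 0) :: real^'d \<Rightarrow> complex)" for j
  define b where "b j = (if j < card I then trig_poly (B (h j)) else (\<lambda>_. 0) :: real^'d \<Rightarrow> complex)" for j
  have zero: "(\<lambda>_. 0) \<in> (L2_torus :: (real^'d \<Rightarrow> complex) set)" by (simp add: L2_torus_def)
  have sum_eq: "(\<Sum>j<k. L2_inner (trig_poly c) (a j) * L2_inner (b j) (trig_poly c'))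
      = (\<Sum>i\<in>I. coeff_inner c (A i) * coeff_inner (B i) c')" if c: "finsupp c" "finsupp c'" for c c'
  proof -
    have "(\<Sum>j<k. L2_inner (trig_poly c) (a j) * L2_inner (b j) (trig_poly c'))
      = (\<Sum>j\<in>{0..<card I}. coeff_inner c (A (h j)) * coeff_inner (B (h j)) c')"
    proof (rule sum.mono_neutral_cong_right)
      show "\<forall>j\<in>{..<k} - {0..<card I}. L2_inner (trig_poly c) (a j) * L2_inner (b j) (trig_poly c') = 0"
        by (simp add: a_def L2_inner_def)
      fix j assume j: "j \<in> {0..<card I}"
      then have "h j \<in> I" using h by (auto simp: bij_betw_def)
      then show "L2_inner (trig_poly c) (a j) * L2_inner (b j) (trig_poly c') = coeff_inner c (A (h j)) * coeff_inner (B (h j)) c'"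
        using j I c by (simp add: a_def b_def L2_inner_trig_poly)
    qed (use I in auto)
    also have "\<dots> = (\<Sum>i\<in>I. coeff_inner c (A i) * coeff_inner (B i) c')"
      by (rule sum.reindex_bij_betw[OF h])
    finally show ?thesis .
  qed
  show ?thesis
    unfolding sandwich_sing_val_def
  proof (rule INF_lower2[where i = "(a, b)"])
    show "(a, b) \<in> {(a, b). \<forall>j<k. a j \<in> L2_torus \<and> b j \<in> L2_torus}"
      by (simp add: a_def b_def trig_poly_in_L2 zero)
    show "(SUP cc \<in> {(c, c'). c \<in> finsupp_coeffs \<and> c' \<in> finsupp_coeffs \<and>
                   L2_norm_torus (trig_poly c) \<le> 1 \<and> L2_norm_torus (trig_poly c') \<le> 1}.
        ereal (cmod (sandwich_form f (fst cc) (snd cc) -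
           (\<Sum>j<k. L2_inner (trig_poly (fst cc)) (fst (a, b) j) * L2_inner (snd (a, b) j) (trig_poly (snd cc)))))) \<le> ereal E"
    proof (rule SUP_least)
      fix cc :: "(('d \<Rightarrow> int) \<Rightarrow> complex) \<times> (('d \<Rightarrow> int) \<Rightarrow> complex)"
      assume "cc \<in> {(c, c'). c \<in> finsupp_coeffs \<and> c' \<in> finsupp_coeffs \<and>
                   L2_norm_torus (trig_poly c) \<le> 1 \<and> L2_norm_torus (trig_poly c') \<le> 1}"
      then obtain c c' where cc: "cc = (c, c')" "finsupp c" "finsupp c'"
          "L2_norm_torus (trig_poly c) \<le> 1" "L2_norm_torus (trig_poly c') \<le> 1"
        by (auto simp: finsupp_coeffs_def finsupp_def)
      then show "ereal (cmod (sandwich_form f (fst cc) (snd cc) -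
           (\<Sum>j<k. L2_inner (trig_poly (fst cc)) (fst (a, b) j) * L2_inner (snd (a, b) j) (trig_poly (snd cc))))) \<le> ereal E"
        using E[of c c'] sum_eq[of c c'] by (simp add: L2_norm_trig_poly)
    qed
  qed
qed

section \<open>Energy with respect to a normalised weight\<close>

text \<open>The intended instance is \<open>|f| / r\<close> with \<open>r\<close> in the set whose
  infimum is the Orlicz norm of \<open>f\<close>.\<close>

locale normalized_weight =
  fixes w :: "real^'d \<Rightarrow> real"
  assumes measurable_w [measurable]: "w \<in> borel_measurable borel"
    and w_nonneg: "w x \<ge> 0"
    and modular_le_1: "(\<integral>\<^sup>+ x. ennreal (M_LlogL (w x)) \<partial>torus_measure) \<le> 1"
begin

definition energy :: "(('d \<Rightarrow> int) \<Rightarrow> complex) \<Rightarrow> real" where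
  "energy c = (\<integral>x. w x * (cmod (half_pot c x))\<^sup>2 \<partial>torus_measure)"

lemma measurable_M_LlogL [measurable]: "M_LlogL \<in> borel_measurable borel"
  unfolding M_LlogL_def[abs_def] by measurable

lemma integrable_modular: "integrable torus_measure (\<lambda>x. M_LlogL (w x))"
  using modular_le_1 by (intro integrableI_nonneg) (auto simp: M_LlogL_nonneg intro: le_less_trans)

lemma integral_modular_le_1: "(\<integral>x. M_LlogL (w x) \<partial>torus_measure) \<le> 1"
  using modular_le_1 nn_integral_eq_integral[OF integrable_modular]
  by (simp add: M_LlogL_nonneg)

lemma integrable_w: "integrable torus_measure w"
  by (rule Bochner_Integration.integrable_bound[OF integrable_modular])
    (auto simp: w_nonneg M_LlogL_nonneg le_M_LlogL)

lemma integrable_energy: "integrable torus_measure (\<lambda>x. w x * (cmod (half_pot c x))\<^sup>2)"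
proof -
  obtain B where "\<And>x. cmod (half_pot c x) \<le> B" using half_pot_bounded[of c] by blast
  then have "(cmod (half_pot c x))\<^sup>2 \<le> B\<^sup>2" for x by (intro power_mono) auto
  then have le: "norm (w x * (cmod (half_pot c x))\<^sup>2) \<le> norm (w x * B\<^sup>2)" for x
    using w_nonneg by (simp add: abs_mult mult_left_mono)
  show ?thesis
    by (rule Bochner_Integration.integrable_bound[OF integrable_mult_left[OF integrable_w, of "B\<^sup>2"]])
      (measurable, intro AE_I2 le)
qed

lemma energy_scale: "finsupp c \<Longrightarrow> energy (\<lambda>n. a * c n) = (cmod a)\<^sup>2 * energy c"
proof -
  assume c: "finsupp c"
  have "w x * (cmod (half_pot (\<lambda>n. a * c n) x))\<^sup>2 = (cmod a)\<^sup>2 * (w x * (cmod (half_pot c x))\<^sup>2)" for x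
    by (simp add: half_pot_scale[OF c] norm_mult power_mult_distrib)
  then show ?thesis by (simp only: energy_def integral_mult_right_zero)
qed

text \<open>At a point \<open>x\<close> with \<open>2\<^bsup>j-1\<^esup> < w x \<le> 2\<^sup>j\<close> the frequencies are cut at \<open>bessel_weight n = t 2\<^sup>j\<close>.
  The part below the cut is controlled by Bessel's inequality and costs \<open>w x * j\<close>, which is where
  the logarithm in \<open>M_LlogL\<close> comes from; the part above is controlled by Parseval.\<close>
lemma sum_energy_le:
  assumes S: "finite S" "coeff_orthonormal S" and t: "t > 0"
    and supp: "\<And>c n. c \<in> S \<Longrightarrow> c n \<noteq> 0 \<Longrightarrow> t < bessel_weight n"
  shows "(\<Sum>c\<in>S. energy c) \<le> 12 * 3 ^ CARD('d) + 4 * card S / t"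
proof -
  define F where "F = (\<Union>c\<in>S. {n. c n \<noteq> 0})"
  have fs: "c \<in> S \<Longrightarrow> finsupp c" for c using S by (auto simp: coeff_orthonormal_def)
  have F: "finite F" using S fs by (auto simp: F_def finsupp_def)
  have cF: "c n = 0" if "c \<in> S" "n \<notin> F" for c n using that by (auto simp: F_def)
  define \<rho> where "\<rho> = Max (insert 1 (bessel_weight ` F))"
  \<comment> \<open>All frequencies in \<open>F\<close> lie below \<open>t * 2 ^ J\<close>, so tails
    at levels \<open>j \<ge> J\<close> are empty and finitely many levels suffice.\<close>
  obtain J :: nat where J0: "\<rho> / t < 2 ^ J" using real_arch_pow[of 2 "\<rho> / t"] by auto
  have J: "bessel_weight n \<le> t * 2 ^ J" if "n \<in> F" for n
  proof -
    have "bessel_weight n \<le> \<rho>" unfolding \<rho>_def using F that by (intro Max_ge) auto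
    then show ?thesis using J0 t by (simp add: field_simps)
  qed
  define tail where "tail c j x = (\<Sum>n\<in>{n\<in>F. t * 2 ^ j < bessel_weight n}. (of_real (bessel_mult n) * c n) * character n x)"
    for c j and x :: "real^'d"
  have [measurable]: "tail c j \<in> borel_measurable borel" for c j unfolding tail_def[abs_def] by measurable
  have tail_int: "integrable torus_measure (\<lambda>x. (cmod (tail c j x))\<^sup>2)" for c j
  proof -
    have "cmod (tail c j x) \<le> (\<Sum>n\<in>{n\<in>F. t * 2 ^ j < bessel_weight n}. cmod (of_real (bessel_mult n) * c n))" for x
      unfolding tail_def by (rule order_trans[OF norm_sum]) (simp add: norm_mult)
    then show ?thesis
      by (intro integrable_torus_bounded[where B = "(\<Sum>n\<in>{n\<in>F. t * 2 ^ j < bessel_weight n}. cmod (of_real (bessel_mult n) * c n))\<^sup>2"])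
        (measurable, auto intro: power_mono)
  qed
  \<comment> \<open>The cut level depends on \<open>x\<close>; summing the tails over all levels
    gives a majorant whose tail part no longer involves \<open>w\<close>, so that Parseval applies
    after integration. The constant 12 is 2 from squaring a sum, 2 from the dyadic shells and 3 from
    \<open>exists_dyadic_level\<close>.\<close>
  define R where "R x = 12 * 3 ^ CARD('d) * M_LlogL (w x) + (\<Sum>c\<in>S. \<Sum>j<J. 2 * 2 ^ j * (cmod (tail c j x))\<^sup>2)" for x
  have pointwise: "(\<Sum>c\<in>S. w x * (cmod (half_pot c x))\<^sup>2) \<le> R x" for x
  proof -
    obtain j :: nat where j: "w x \<le> 2 ^ j" "w x * real j \<le> 3 * M_LlogL (w x)"
      using exists_dyadic_level[OF w_nonneg] by blast
    define G where "G = {n :: 'd \<Rightarrow> int. t < bessel_weight n \<and> bessel_weight n \<le> t * 2 ^ j}"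
    have G: "finite G" unfolding G_def by (rule finite_subset[OF _ finite_bessel_weight_le[of "t * 2 ^ j"]]) auto
    \<comment> \<open>The vector representing evaluation at \<open>x\<close> of the low-frequency
      part: for \<open>c\<close> in \<open>S\<close>, \<open>coeff_inner c a\<close> is that part of
      \<open>half_pot c x\<close>. Characters have modulus 1, so its norm does not depend on
      \<open>x\<close> beyond the choice of \<open>j\<close>.\<close>
    define a where "a n = (if n \<in> G then cnj (of_real (bessel_mult n) * character n x) else 0)" for n
    have a: "finsupp a" unfolding a_def using G by auto
    have "coeff_normsq a = (\<Sum>n\<in>G. 1 / bessel_weight n)"
      by (subst coeff_normsq_superset[OF G])
        (auto simp: a_def norm_mult power_mult_distrib bessel_mult_square)
    also have "\<dots> \<le> 2 * 3 ^ CARD('d) * real j"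
      unfolding G_def by (rule sum_inverse_bessel_weight_dyadic[OF t])
    \<comment> \<open>Bessel's inequality for \<open>a\<close> against the system \<open>S\<close>
      gives a bound that does not grow with \<open>card S\<close>.\<close>
    finally have low: "(\<Sum>c\<in>S. (cmod (coeff_inner a c))\<^sup>2) \<le> 2 * 3 ^ CARD('d) * real j"
      using coeff_bessel[OF S a] by linarith
    have each: "w x * (cmod (half_pot c x))\<^sup>2 \<le> 2 * w x * (cmod (coeff_inner a c))\<^sup>2 + (\<Sum>j<J. 2 * 2 ^ j * (cmod (tail c j x))\<^sup>2)"
      if c: "c \<in> S" for c
    proof -
      let ?g = "\<lambda>n. (of_real (bessel_mult n) * c n) * character n x"
      have "half_pot c x = (\<Sum>n\<in>F. ?g n)" by (rule half_pot_superset[OF F]) (rule cF[OF c])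
      also have "\<dots> = (\<Sum>n\<in>{n\<in>F. \<not> t * 2 ^ j < bessel_weight n}. ?g n) + tail c j x"
        unfolding tail_def using F
        by (subst sum.union_disjoint[symmetric]) (auto intro!: sum.cong)
      also have "(\<Sum>n\<in>{n\<in>F. \<not> t * 2 ^ j < bessel_weight n}. ?g n) = coeff_inner c a"
      proof -
        have "coeff_inner c a = (\<Sum>n\<in>{n\<in>F. \<not> t * 2 ^ j < bessel_weight n}. c n * cnj (a n))"
          using F cF[OF c] by (intro coeff_inner_superset fs c) (auto simp: a_def G_def)
        \<comment> \<open>Elements of \<open>S\<close> vanish where the weight is at most
          \<open>t\<close>, so cutting \<open>a\<close> off there loses nothing.\<close>
        also have "\<dots> = (\<Sum>n\<in>{n\<in>F. \<not> t * 2 ^ j < bessel_weight n}. ?g n)"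
          using supp[OF c] by (intro sum.cong refl) (force simp: a_def G_def not_less)
        finally show ?thesis by simp
      qed
      finally have "cmod (half_pot c x) \<le> cmod (coeff_inner c a) + cmod (tail c j x)"
        by (simp add: norm_triangle_ineq)
      then have "(cmod (half_pot c x))\<^sup>2 \<le> (cmod (coeff_inner c a) + cmod (tail c j x))\<^sup>2"
        by (intro power_mono) auto
      also have "\<dots> \<le> 2 * (cmod (coeff_inner c a))\<^sup>2 + 2 * (cmod (tail c j x))\<^sup>2"
        using sum_squares_bound[of "cmod (coeff_inner c a)" "cmod (tail c j x)"] by (simp add: power2_sum)
      finally have "w x * (cmod (half_pot c x))\<^sup>2 \<le> w x * (2 * (cmod (coeff_inner c a))\<^sup>2 + 2 * (cmod (tail c j x))\<^sup>2)"
        using w_nonneg by (intro mult_left_mono)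
      also have "\<dots> = 2 * w x * (cmod (coeff_inner a c))\<^sup>2 + 2 * (w x * (cmod (tail c j x))\<^sup>2)"
        using coeff_inner_commute[OF a fs[OF c]] by (simp add: algebra_simps)
      also have "2 * (w x * (cmod (tail c j x))\<^sup>2) \<le> 2 * (2 ^ j * (cmod (tail c j x))\<^sup>2)"
        using j by (intro mult_left_mono mult_right_mono) auto
      also have "2 * (2 ^ j * (cmod (tail c j x))\<^sup>2) \<le> (\<Sum>j<J. 2 * 2 ^ j * (cmod (tail c j x))\<^sup>2)"
      proof (cases "j < J")
        case True
        then have "2 * 2 ^ j * (cmod (tail c j x))\<^sup>2 \<le> (\<Sum>j<J. 2 * 2 ^ j * (cmod (tail c j x))\<^sup>2)"
          by (intro member_le_sum) auto
        then show ?thesis by simp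
      next
        case False
        then have "t * 2 ^ J \<le> t * 2 ^ j" using t by simp
        then have "{n\<in>F. t * 2 ^ j < bessel_weight n} = {}"
          using J by (auto simp: not_less intro: order_trans)
        then have "tail c j x = 0" by (simp only: tail_def sum.empty)
        then show ?thesis by (simp add: sum_nonneg)
      qed
      finally show ?thesis by simp
    qed
    have "(\<Sum>c\<in>S. w x * (cmod (half_pot c x))\<^sup>2)
      \<le> 2 * w x * (\<Sum>c\<in>S. (cmod (coeff_inner a c))\<^sup>2) + (\<Sum>c\<in>S. \<Sum>j<J. 2 * 2 ^ j * (cmod (tail c j x))\<^sup>2)"
      unfolding sum_distrib_left sum.distrib[symmetric] by (intro sum_mono each)
    also have "2 * w x * (\<Sum>c\<in>S. (cmod (coeff_inner a c))\<^sup>2) \<le> 2 * w x * (2 * 3 ^ CARD('d) * real j)"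
      using low w_nonneg by (intro mult_left_mono) auto
    also have "\<dots> = 4 * 3 ^ CARD('d) * (w x * real j)" by simp
    also have "\<dots> \<le> 4 * 3 ^ CARD('d) * (3 * M_LlogL (w x))" using j by (intro mult_left_mono) auto
    finally show ?thesis by (simp add: R_def)
  qed
  \<comment> \<open>After Parseval and exchanging the sums, a frequency of weight
    \<open>\<rho>\<close> collects the geometric sum of all \<open>2 ^ j < \<rho> / t\<close>, at
    most \<open>2 * \<rho> / t\<close>; this cancels the factor \<open>1 / \<rho>\<close> of the
    multiplier.\<close>
  have tail_norm: "(\<Sum>j<J. 2 * 2 ^ j * (\<integral>x. (cmod (tail c j x))\<^sup>2 \<partial>torus_measure)) \<le> 4 / t" if c: "c \<in> S" for c
  proof -
    have "(\<Sum>j<J. 2 * 2 ^ j * (\<integral>x. (cmod (tail c j x))\<^sup>2 \<partial>torus_measure))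
      = (\<Sum>j<J. \<Sum>n\<in>F. (if t * 2 ^ j < bessel_weight n then 2 ^ j else 0) * (2 * (cmod (c n))\<^sup>2 / bessel_weight n))"
    proof (intro sum.cong refl)
      fix j
      have "(\<integral>x. (cmod (tail c j x))\<^sup>2 \<partial>torus_measure)
          = (\<Sum>n\<in>{n\<in>F. t * 2 ^ j < bessel_weight n}. (cmod (of_real (bessel_mult n) * c n))\<^sup>2)"
        unfolding tail_def using F by (intro parseval_character_sum) auto
      also have "\<dots> = (\<Sum>n\<in>{n\<in>F. t * 2 ^ j < bessel_weight n}. (cmod (c n))\<^sup>2 / bessel_weight n)"
        by (intro sum.cong refl) (simp add: norm_mult power_mult_distrib bessel_mult_square)
      also have "\<dots> = (\<Sum>n\<in>F. if t * 2 ^ j < bessel_weight n then (cmod (c n))\<^sup>2 / bessel_weight n else 0)"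
        by (rule sum.inter_filter[OF F])
      finally show "2 * 2 ^ j * (\<integral>x. (cmod (tail c j x))\<^sup>2 \<partial>torus_measure)
        = (\<Sum>n\<in>F. (if t * 2 ^ j < bessel_weight n then 2 ^ j else 0) * (2 * (cmod (c n))\<^sup>2 / bessel_weight n))"
        by (simp only: sum_distrib_left) (intro sum.cong refl, simp)
    qed
    also have "\<dots> = (\<Sum>n\<in>F. (\<Sum>j<J. if t * 2 ^ j < bessel_weight n then 2 ^ j else 0) * (2 * (cmod (c n))\<^sup>2 / bessel_weight n))"
      by (subst sum.swap) (simp only: sum_distrib_right)
    also have "\<dots> \<le> (\<Sum>n\<in>F. (2 * bessel_weight n / t) * (2 * (cmod (c n))\<^sup>2 / bessel_weight n))"
      using less_imp_le[OF bessel_weight_pos]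
      by (intro sum_mono mult_right_mono sum_dyadic_below t bessel_weight_pos divide_nonneg_nonneg) auto
    also have "\<dots> = 4 / t * (\<Sum>n\<in>F. (cmod (c n))\<^sup>2)"
      unfolding sum_distrib_left by (intro sum.cong refl) simp
    also have "(\<Sum>n\<in>F. (cmod (c n))\<^sup>2) = coeff_normsq c"
      by (rule coeff_normsq_superset[symmetric, OF F]) (rule cF[OF c])
    also have "coeff_normsq c = 1"
      using S c coeff_inner_self[of c] by (auto simp: coeff_orthonormal_def)
    finally show ?thesis by simp
  qed
  have R_int: "integrable torus_measure R"
    unfolding R_def[abs_def]
    by (intro Bochner_Integration.integrable_add Bochner_Integration.integrable_sum integrable_mult_right integrable_modular tail_int)
  have "(\<Sum>c\<in>S. energy c) = (\<integral>x. (\<Sum>c\<in>S. w x * (cmod (half_pot c x))\<^sup>2) \<partial>torus_measure)"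
    unfolding energy_def by (rule Bochner_Integration.integral_sum[symmetric]) (rule integrable_energy)
  also have "\<dots> \<le> (\<integral>x. R x \<partial>torus_measure)"
    by (intro integral_mono R_int Bochner_Integration.integrable_sum integrable_energy pointwise)
  also have "\<dots> = 12 * 3 ^ CARD('d) * (\<integral>x. M_LlogL (w x) \<partial>torus_measure)
      + (\<Sum>c\<in>S. \<Sum>j<J. 2 * 2 ^ j * (\<integral>x. (cmod (tail c j x))\<^sup>2 \<partial>torus_measure))"
    unfolding R_def
    by (simp add: integrable_modular tail_int Bochner_Integration.integral_add Bochner_Integration.integral_sum)
  also have "\<dots> \<le> 12 * 3 ^ CARD('d) * 1 + (\<Sum>c\<in>S. 4 / t)"
    by (intro add_mono mult_left_mono integral_modular_le_1 sum_mono tail_norm) auto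
  finally show ?thesis by (simp add: mult.commute)
qed

text \<open>The bound for systems, applied to the single normalised vector at
  \<open>t = 1/2\<close>: all weights are at least 1, so every frequency counts as high, and
  \<open>4 / t = 8\<close>. The zero vector cannot be normalised and is treated apart.\<close>

lemma energy_le: 
  assumes c: "finsupp c"
  shows "energy c \<le> (12 * 3 ^ CARD('d) + 8) * coeff_normsq c"
proof (cases "coeff_normsq c = 0")
  case True
  then have "c n = 0" for n using coeff_normsq_pos[OF c, of n] by (metis less_irrefl)
  then have "half_pot c x = 0" for x by (simp add: half_pot_eq)
  then show ?thesis using True by (simp add: energy_def)
next
  case False
  then have pos: "coeff_normsq c > 0" using coeff_normsq_nonneg[of c] by linarith
  define a where "a = 1 / complex_of_real (sqrt (coeff_normsq c))"
  have a: "(cmod a)\<^sup>2 = 1 / coeff_normsq c"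
    using pos by (simp add: a_def norm_divide power_divide)
  define c' where "c' = (\<lambda>n. a * c n)"
  have "coeff_normsq c' = 1" using c a pos by (simp add: c'_def coeff_normsq_scale)
  then have "coeff_orthonormal {c'}"
    using c by (auto simp: coeff_orthonormal_def c'_def coeff_inner_self)
  moreover have "1 / 2 < bessel_weight n" for n :: "'d \<Rightarrow> int"
    using bessel_weight_ge_1[of n] by linarith
  ultimately have "energy c' \<le> 12 * 3 ^ CARD('d) + 8"
    using sum_energy_le[of "{c'}" "1 / 2"] by simp
  moreover have "energy c' = energy c / coeff_normsq c"
    using c a by (simp add: c'_def energy_scale)
  ultimately show ?thesis using pos by (simp add: field_simps)
qed

text \<open>The set consists of the low frequencies and of a maximal orthonormal system of high-frequency
  vectors of large energy, whose size is bounded by \<open>sum_energy_le\<close>.\<close>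
lemma exists_exceptional_set:
  assumes t: "t > 0"
  obtains T where "finite T" "coeff_orthonormal T" "real (card T) \<le> 13 * 3 ^ CARD('d) * t"
    "\<And>c. finsupp c \<Longrightarrow> (\<And>s. s \<in> T \<Longrightarrow> coeff_inner c s = 0) \<Longrightarrow> energy c \<le> 5 / t * coeff_normsq c"
proof -
  define P where "P S \<longleftrightarrow> finite S \<and> coeff_orthonormal S \<and> (\<forall>c\<in>S. \<forall>n. c n \<noteq> 0 \<longrightarrow> t < bessel_weight n) \<and>
    (\<forall>c\<in>S. energy c > 5 / t)" for S
  \<comment> \<open>The threshold \<open>5 / t\<close> beats the \<open>4 / t\<close> per vector
    allowed by \<open>sum_energy_le\<close>; the surplus \<open>1 / t\<close> per vector bounds the
    cardinality.\<close>
  have card_P: "real (card S) \<le> 12 * 3 ^ CARD('d) * t" if S: "P S" for S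
  proof -
    have "5 / t * card S \<le> (\<Sum>c\<in>S. energy c)"
      using S sum_bounded_below[of S "5 / t" energy] by (simp add: P_def less_imp_le mult.commute)
    also have "\<dots> \<le> 12 * 3 ^ CARD('d) + 4 * card S / t"
      using S t by (intro sum_energy_le) (auto simp: P_def)
    finally show ?thesis using t by (simp add: field_simps)
  qed
  have "P {}" by (simp add: P_def coeff_orthonormal_def)
  moreover have "card S < Suc (nat \<lceil>12 * 3 ^ CARD('d) * t\<rceil>)" if "P S" for S
    using card_P[OF that] real_nat_ceiling_ge[of "12 * 3 ^ CARD('d) * t"] by linarith
  ultimately obtain S where S: "P S" and S_max: "\<And>S'. P S' \<Longrightarrow> card S' \<le> card S"
    using ex_has_greatest_nat[of P "{}" card "Suc (nat \<lceil>12 * 3 ^ CARD('d) * t\<rceil>)"] by blast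
  define \<delta> :: "('d \<Rightarrow> int) \<Rightarrow> ('d \<Rightarrow> int) \<Rightarrow> complex" where "\<delta> m n = (if n = m then 1 else 0)" for m n
  have \<delta>: "finsupp (\<delta> m)" for m by (simp add: finsupp_def \<delta>_def)
  have inner_\<delta>: "coeff_inner c (\<delta> m) = c m" if c: "finsupp c" for c m
    using coeff_inner_superset[OF c, of "{m}" "\<delta> m"] by (simp add: \<delta>_def)
  define L where "L = {n :: 'd \<Rightarrow> int. bessel_weight n \<le> t}"
  \<comment> \<open>The unit vectors at low frequencies are included so that orthogonality to
    \<open>T\<close> forces a vector to be supported where the weight exceeds
    \<open>t\<close>.\<close>
  define T where "T = S \<union> \<delta> ` L"
  have L: "finite L" unfolding L_def by (rule finite_bessel_weight_le)
  have fS: "finite S" "\<And>s. s \<in> S \<Longrightarrow> finsupp s" and oS: "coeff_orthonormal S"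
    using S by (auto simp: P_def coeff_orthonormal_def)
  have S0: "s m = 0" if "s \<in> S" "m \<in> L" for s m
    using S that by (force simp: P_def L_def)
  have fT: "finite T" using fS L by (simp add: T_def)
  have SL: "coeff_inner s (\<delta> m) = 0" "coeff_inner (\<delta> m) s = 0" "s \<noteq> \<delta> m" "\<delta> m \<noteq> s" if "s \<in> S" "m \<in> L" for s m
  proof -
    show "coeff_inner s (\<delta> m) = 0" using inner_\<delta>[OF fS(2)[OF that(1)]] S0[OF that] by simp
    then show "coeff_inner (\<delta> m) s = 0" using coeff_inner_commute[OF fS(2)[OF that(1)] \<delta>, of m] by simp
    show "s \<noteq> \<delta> m" using S0[OF that] by (auto simp: \<delta>_def)
    then show "\<delta> m \<noteq> s" by simp
  qed
  have \<delta>_eq: "\<delta> m = \<delta> m' \<longleftrightarrow> m = m'" for m m' by (auto simp: \<delta>_def fun_eq_iff split: if_splits)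
  have oT: "coeff_orthonormal T"
    unfolding coeff_orthonormal_def
  proof (intro conjI ballI)
    show "finsupp s" if "s \<in> T" for s using that fS \<delta> by (auto simp: T_def)
    show "coeff_inner s s' = (if s = s' then 1 else 0)" if "s \<in> T" "s' \<in> T" for s s'
      using that oS unfolding T_def coeff_orthonormal_def
      by (auto simp: SL inner_\<delta>[OF \<delta>] \<delta>_eq) (auto simp: \<delta>_def)
  qed
  have "real (card T) \<le> real (card S) + real (card L)"
    unfolding T_def using card_Un_le[of S "\<delta> ` L"] card_image_le[OF L, of \<delta>] by linarith
  also have "\<dots> \<le> 12 * 3 ^ CARD('d) * t + 3 ^ CARD('d) * t"
    unfolding L_def by (intro add_mono card_P S card_bessel_weight_le t)
  finally have card_T: "real (card T) \<le> 13 * 3 ^ CARD('d) * t" by (simp add: mult_ac)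
  have "energy c \<le> 5 / t * coeff_normsq c"
    if c: "finsupp c" and orth: "\<And>s. s \<in> T \<Longrightarrow> coeff_inner c s = 0" for c
  proof (rule ccontr)
    assume neg: "\<not> energy c \<le> 5 / t * coeff_normsq c"
    \<comment> \<open>A vector of norm zero has energy at most zero by \<open>energy_le\<close>, so
      a violating vector can be normalised.\<close>
    have pos: "coeff_normsq c > 0"
    proof (rule ccontr)
      assume "\<not> coeff_normsq c > 0"
      then have "coeff_normsq c = 0" using coeff_normsq_nonneg[of c] by linarith
      then show False using neg energy_le[OF c] by simp
    qed
    define a where "a = 1 / complex_of_real (sqrt (coeff_normsq c))"
    have a: "(cmod a)\<^sup>2 = 1 / coeff_normsq c"
      using pos by (simp add: a_def norm_divide power_divide)
    define c' where "c' = (\<lambda>n. a * c n)"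
    have fc': "finsupp c'" using c by (auto simp: c'_def)
    have n1: "coeff_normsq c' = 1" using c a pos by (simp add: c'_def coeff_normsq_scale)
    have orth': "coeff_inner c' s = 0" "coeff_inner s c' = 0" if "s \<in> S" for s
    proof -
      show "coeff_inner c' s = 0" using c that orth[of s] by (simp add: c'_def coeff_inner_scale_left T_def)
      then show "coeff_inner s c' = 0" using coeff_inner_commute[OF fc' fS(2)[OF that]] by simp
    qed
    have notin: "c' \<notin> S" using orth'(1)[of c'] n1 coeff_inner_self[of c'] by auto
    \<comment> \<open>The normalised violating vector would enlarge \<open>S\<close>, against its
      maximal cardinality.\<close>
    have "P (insert c' S)"
      unfolding P_def
    proof (intro conjI)
      show "finite (insert c' S)" using fS by simp
      show "coeff_orthonormal (insert c' S)"
        using oS fc' notin orth' n1 coeff_inner_self[of c'] unfolding coeff_orthonormal_def by auto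
      have "t < bessel_weight n" if n: "c' n \<noteq> 0" for n
      proof (rule ccontr)
        assume "\<not> t < bessel_weight n"
        then have "\<delta> n \<in> T" by (auto simp: T_def L_def)
        then have "c n = 0" using orth[of "\<delta> n"] inner_\<delta>[OF c, of n] by simp
        then show False using n by (simp add: c'_def)
      qed
      then show "\<forall>c\<in>insert c' S. \<forall>n. c n \<noteq> 0 \<longrightarrow> t < bessel_weight n"
        using S by (auto simp: P_def)
      have "energy c' = energy c / coeff_normsq c" using c a by (simp add: c'_def energy_scale)
      then have "energy c' > 5 / t" using neg pos by (simp add: pos_less_divide_eq)
      then show "\<forall>c\<in>insert c' S. 5 / t < energy c" using S by (auto simp: P_def)
    qed
    then have "card (insert c' S) \<le> card S" by (rule S_max)
    then show False using fS notin by simp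
  qed
  then show ?thesis using that[OF fT oT card_T] by blast
qed

end

section \<open>The sandwiched multiplication operator\<close>

lemma sandwich_form_eq:
  "sandwich_form f c c' = (\<integral>x. f x * half_pot c x * cnj (half_pot c' x) \<partial>torus_measure)"
  by (simp add: sandwich_form_def half_pot_def)

lemma integrable_sandwich:
  fixes f :: "real^'d \<Rightarrow> complex"
  assumes "integrable torus_measure f"
  shows "integrable torus_measure (\<lambda>x. f x * half_pot c x * cnj (half_pot c' x))"
proof -
  have [measurable]: "f \<in> borel_measurable borel"
    using borel_measurable_integrable[OF assms] by (simp add: measurable_cong_sets[OF sets_torus_measure refl])
  obtain B B' where B: "\<And>x. cmod (half_pot c x) \<le> B" "\<And>x. cmod (half_pot c' x) \<le> B'"
    using half_pot_bounded[of c] half_pot_bounded[of c'] by blast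
  have le: "norm (f x * half_pot c x * cnj (half_pot c' x)) \<le> norm (of_real (B * B') * f x)" for x
  proof -
    have "cmod (half_pot c x) * cmod (half_pot c' x) \<le> \<bar>B * B'\<bar>"
      using B[of x] by (intro order_trans[OF mult_mono abs_ge_self]) (auto intro: order_trans[OF norm_ge_zero])
    then have "cmod (f x) * (cmod (half_pot c x) * cmod (half_pot c' x)) \<le> cmod (f x) * \<bar>B * B'\<bar>"
      by (intro mult_left_mono) auto
    then show ?thesis by (simp add: norm_mult abs_mult mult_ac)
  qed
  show ?thesis
    by (rule Bochner_Integration.integrable_bound[OF integrable_mult_right[OF assms, of "of_real (B * B')"]])
      (measurable, intro AE_I2 le)
qed

lemma sandwich_form_diff_left:
  assumes f: "integrable torus_measure f" and "finsupp c" "finsupp d"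
  shows "sandwich_form f (\<lambda>n. c n - d n) c' = sandwich_form f c c' - sandwich_form f d c'"
  unfolding sandwich_form_eq half_pot_diff[OF assms(2,3)]
  by (simp only: left_diff_distrib right_diff_distrib complex_cnj_diff
      Bochner_Integration.integral_diff[OF integrable_sandwich[OF f] integrable_sandwich[OF f]])

lemma sandwich_form_diff_right:
  assumes f: "integrable torus_measure f" and "finsupp c'" "finsupp d"
  shows "sandwich_form f c (\<lambda>n. c' n - d n) = sandwich_form f c c' - sandwich_form f c d"
  unfolding sandwich_form_eq half_pot_diff[OF assms(2,3)]
  by (simp only: left_diff_distrib right_diff_distrib complex_cnj_diff
      Bochner_Integration.integral_diff[OF integrable_sandwich[OF f] integrable_sandwich[OF f]])

lemma sandwich_form_sum_left:
  assumes f: "integrable torus_measure f" and I: "finite I" "\<And>i. i \<in> I \<Longrightarrow> finsupp (h i)"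
  shows "sandwich_form f (\<lambda>n. \<Sum>i\<in>I. k i * h i n) c' = (\<Sum>i\<in>I. k i * sandwich_form f (h i) c')"
proof -
  have "sandwich_form f (\<lambda>n. \<Sum>i\<in>I. k i * h i n) c'
      = (\<integral>x. (\<Sum>i\<in>I. k i * (f x * half_pot (h i) x * cnj (half_pot c' x))) \<partial>torus_measure)"
    unfolding sandwich_form_eq by (simp add: half_pot_sum[OF I] sum_distrib_left sum_distrib_right mult_ac)
  also have "\<dots> = (\<Sum>i\<in>I. k i * sandwich_form f (h i) c')"
    unfolding sandwich_form_eq
    by (subst Bochner_Integration.integral_sum) (auto intro!: integrable_mult_right integrable_sandwich[OF f])
  finally show ?thesis .
qed

lemma sandwich_form_sum_right:
  assumes f: "integrable torus_measure f" and I: "finite I" "\<And>i. i \<in> I \<Longrightarrow> finsupp (h i)"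
  shows "sandwich_form f c (\<lambda>n. \<Sum>i\<in>I. k i * h i n) = (\<Sum>i\<in>I. cnj (k i) * sandwich_form f c (h i))"
proof -
  have "sandwich_form f c (\<lambda>n. \<Sum>i\<in>I. k i * h i n)
      = (\<integral>x. (\<Sum>i\<in>I. cnj (k i) * (f x * half_pot c x * cnj (half_pot (h i) x))) \<partial>torus_measure)"
    unfolding sandwich_form_eq by (simp add: half_pot_sum[OF I] sum_distrib_left sum_distrib_right mult_ac)
  also have "\<dots> = (\<Sum>i\<in>I. cnj (k i) * sandwich_form f c (h i))"
    unfolding sandwich_form_eq
    by (subst Bochner_Integration.integral_sum) (auto intro!: integrable_mult_right integrable_sandwich[OF f])
  finally show ?thesis .
qed

text \<open>Pointwise arithmetic-geometric mean inequality. Only the modulus of \<open>f\<close>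
  enters, so bounds on the nonnegative energy carry over to complex-valued \<open>f\<close>.\<close>

lemma (in normalized_weight) sandwich_form_le:
  assumes f: "integrable torus_measure f" and fw: "\<And>x. cmod (f x) = r * w x" and r: "r > 0"
  shows "cmod (sandwich_form f c c') \<le> r / 2 * (energy c + energy c')"
proof -
  have "cmod (sandwich_form f c c') \<le> (\<integral>x. cmod (f x * half_pot c x * cnj (half_pot c' x)) \<partial>torus_measure)"
    unfolding sandwich_form_eq by (rule integral_norm_bound)
  also have "\<dots> \<le> (\<integral>x. r / 2 * (w x * (cmod (half_pot c x))\<^sup>2 + w x * (cmod (half_pot c' x))\<^sup>2) \<partial>torus_measure)"
  proof (rule integral_mono)
    show "integrable torus_measure (\<lambda>x. cmod (f x * half_pot c x * cnj (half_pot c' x)))"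
      by (intro integrable_norm integrable_sandwich f)
    show "integrable torus_measure (\<lambda>x. r / 2 * (w x * (cmod (half_pot c x))\<^sup>2 + w x * (cmod (half_pot c' x))\<^sup>2))"
      by (intro integrable_mult_right Bochner_Integration.integrable_add integrable_energy)
    fix x
    have "cmod (f x * half_pot c x * cnj (half_pot c' x)) = (r * w x) * (cmod (half_pot c x) * cmod (half_pot c' x))"
      by (simp add: norm_mult fw)
    also have "\<dots> \<le> (r * w x) * (((cmod (half_pot c x))\<^sup>2 + (cmod (half_pot c' x))\<^sup>2) / 2)"
      using sum_squares_bound[of "cmod (half_pot c x)" "cmod (half_pot c' x)"] r w_nonneg[of x]
      by (intro mult_left_mono) auto
    finally show "cmod (f x * half_pot c x * cnj (half_pot c' x))
      \<le> r / 2 * (w x * (cmod (half_pot c x))\<^sup>2 + w x * (cmod (half_pot c' x))\<^sup>2)"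
      by (simp add: algebra_simps)
  qed
  also have "\<dots> = r / 2 * (energy c + energy c')"
    unfolding energy_def by (simp add: Bochner_Integration.integral_add integrable_energy)
  finally show ?thesis .
qed

text \<open>Remove the projection onto the exceptional system \<open>T\<close> from both arguments.
  The form of the two residuals is at most \<open>5 * r / t\<close>; the remaining terms have rank
  at most \<open>2 * card T\<close>, which the hypothesis on \<open>k\<close> keeps within
  \<open>k\<close>.\<close>

lemma (in normalized_weight) sandwich_sing_val_weight_le:
  fixes f :: "real^'d \<Rightarrow> complex"
  assumes fw: "\<And>x. cmod (f x) = r * w x" and r: "r > 0"
    and f_meas: "f \<in> borel_measurable borel"
    and t: "t > 0" and k: "26 * 3 ^ CARD('d) * t < real k + 1"
  shows "sandwich_sing_val f k \<le> ereal (5 * r / t)"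
proof -
  have f: "integrable torus_measure f"
    by (rule Bochner_Integration.integrable_bound[OF integrable_mult_right[OF integrable_w, of r]])
      (use f_meas fw w_nonneg r in \<open>auto simp: measurable_cong_sets[OF sets_torus_measure refl]\<close>)
  obtain T where T: "finite T" "coeff_orthonormal T" "real (card T) \<le> 13 * 3 ^ CARD('d) * t"
    and T_orth: "\<And>c. finsupp c \<Longrightarrow> (\<And>s. s \<in> T \<Longrightarrow> coeff_inner c s = 0) \<Longrightarrow> energy c \<le> 5 / t * coeff_normsq c"
    using exists_exceptional_set[OF t] by blast
  have fT: "s \<in> T \<Longrightarrow> finsupp s" and nT: "s \<in> T \<Longrightarrow> coeff_normsq s = 1" for s
    using T(2) coeff_inner_self[of s] by (auto simp: coeff_orthonormal_def)
  define Q where "Q c = (\<lambda>n. c n - coeff_proj T c n)" for c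
  define K where "K = 12 * 3 ^ CARD('d) + (8 :: real)"
  have K: "energy c \<le> K" if "finsupp c" "coeff_normsq c \<le> 1" for c
  proof -
    have "energy c \<le> K * coeff_normsq c" unfolding K_def by (rule energy_le[OF that(1)])
    also have "\<dots> \<le> K * 1" using that by (intro mult_left_mono) (auto simp: K_def)
    finally show ?thesis by simp
  qed
  have fP: "finsupp (coeff_proj T c)" for c by (rule finsupp_coeff_proj[OF T(1,2)])
  have fQ: "finsupp (Q c)" if "finsupp c" for c unfolding Q_def using that fP by (rule finsupp_diff)
  have nQ: "coeff_normsq (Q c) \<le> 1" if "finsupp c" "coeff_normsq c \<le> 1" for c
    using coeff_normsq_residual[OF T(1,2) that(1)] that(2)
      sum_nonneg[of T "\<lambda>s. (cmod (coeff_inner c s))\<^sup>2"] by (simp add: Q_def)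
  have Q_small: "energy (Q c) \<le> 5 / t" if c: "finsupp c" "coeff_normsq c \<le> 1" for c
  proof -
    have "energy (Q c) \<le> 5 / t * coeff_normsq (Q c)"
      using coeff_inner_residual[OF T(1,2) _ c(1)] by (intro T_orth fQ c) (simp add: Q_def)
    also have "\<dots> \<le> 5 / t * 1" using nQ[OF c] t by (intro mult_left_mono) auto
    finally show ?thesis by simp
  qed
  have form_Q_left: "sandwich_form f (Q c) d = sandwich_form f c d - (\<Sum>s\<in>T. coeff_inner c s * sandwich_form f s d)"
    if "finsupp c" for c d
  proof -
    have "sandwich_form f (Q c) d = sandwich_form f c d - sandwich_form f (coeff_proj T c) d"
      unfolding Q_def by (rule sandwich_form_diff_left[OF f that fP])
    then show ?thesis
      unfolding coeff_proj_def by (simp add: sandwich_form_sum_left[OF f T(1) fT])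
  qed
  have form_Q_right: "sandwich_form f c (Q d) = sandwich_form f c d - (\<Sum>s\<in>T. cnj (coeff_inner d s) * sandwich_form f c s)"
    if "finsupp d" for c d
  proof -
    have "sandwich_form f c (Q d) = sandwich_form f c d - sandwich_form f c (coeff_proj T d)"
      unfolding Q_def by (rule sandwich_form_diff_right[OF f that fP])
    then show ?thesis
      unfolding coeff_proj_def by (simp add: sandwich_form_sum_right[OF f T(1) fT])
  qed
  \<comment> \<open>This crude bound supplies the boundedness required by
    \<open>bounded_functional_approx\<close>.\<close>
  have bound: "cmod (sandwich_form f c d) \<le> r * K"
    if "finsupp c" "coeff_normsq c \<le> 1" "finsupp d" "coeff_normsq d \<le> 1" for c d
  proof -
    have "cmod (sandwich_form f c d) \<le> r / 2 * (energy c + energy d)" by (rule sandwich_form_le[OF f fw r])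
    also have "\<dots> \<le> r / 2 * (K + K)" using K that r by (intro mult_left_mono add_mono) auto
    finally show ?thesis by simp
  qed
  text \<open>The functionals in the two finite-rank terms are not represented exactly: approximating
    them by trigonometric polynomials avoids the completeness of \<open>L\<^sub>2\<close>, and the infimum in the
    singular value absorbs the error.\<close>
  have "sandwich_sing_val f k \<le> ereal (5 * r / t) + ereal \<eta>" if \<eta>: "\<eta> > 0" for \<eta>
  proof -
    \<comment> \<open>There are \<open>2 * card T\<close> approximated functionals, each costing at
      most \<open>\<epsilon>\<close>; the added 1 keeps the denominator positive when
      \<open>T\<close> is empty.\<close>
    define \<epsilon> where "\<epsilon> = \<eta> / (2 * real (card T) + 1)"
    have \<epsilon>: "\<epsilon> > 0" using \<eta> by (simp add: \<epsilon>_def)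
    define rep where "rep \<psi> a \<longleftrightarrow> finsupp a \<and>
        (\<forall>c. finsupp c \<longrightarrow> coeff_normsq c \<le> 1 \<longrightarrow> cmod (\<psi> c - coeff_inner c a) \<le> \<epsilon>)"
      for \<psi> :: "(('d \<Rightarrow> int) \<Rightarrow> complex) \<Rightarrow> complex" and a
    \<comment> \<open>The form is conjugate-linear in its second argument, so it is conjugated to
      give a linear functional.\<close>
    have "\<exists>a. rep (\<lambda>c. cnj (sandwich_form f s c)) a" if s: "s \<in> T" for s
      unfolding rep_def
    proof (rule bounded_functional_approx[OF _ _ \<epsilon>])
      show "cnj (sandwich_form f s (\<lambda>n. \<Sum>i\<in>I. k i * h i n)) = (\<Sum>i\<in>I. k i * cnj (sandwich_form f s (h i)))"
        if "finite I" "\<And>i. i \<in> I \<Longrightarrow> finsupp (h i)" for I :: "('d \<Rightarrow> int) set" and k h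
        by (simp add: sandwich_form_sum_right[OF f that])
      show "cmod (cnj (sandwich_form f s c)) \<le> r * K" if "finsupp c" "coeff_normsq c \<le> 1" for c
        using bound[OF fT[OF s] _ that] nT[OF s] by simp
    qed
    then have "\<forall>s\<in>T. \<exists>a. rep (\<lambda>c. cnj (sandwich_form f s c)) a" by (rule ballI)
    from bchoice[OF this] obtain \<beta> where "\<forall>s\<in>T. rep (\<lambda>c. cnj (sandwich_form f s c)) (\<beta> s)"
      by (elim exE)
    then have \<beta>: "finsupp (\<beta> s)" "finsupp c \<Longrightarrow> coeff_normsq c \<le> 1 \<Longrightarrow>
        cmod (cnj (sandwich_form f s c) - coeff_inner c (\<beta> s)) \<le> \<epsilon>" if "s \<in> T" for s c
      using that by (simp_all add: rep_def)
    \<comment> \<open>By \<open>form_Q_left\<close> this functional is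
      \<open>sandwich_form f (Q c) s\<close>, the coefficient left over once the first argument has
      been projected.\<close>
    have "\<exists>a. rep (\<lambda>c. sandwich_form f c s - (\<Sum>s'\<in>T. coeff_inner c s' * sandwich_form f s' s)) a"
      if s: "s \<in> T" for s
      unfolding rep_def
    proof (rule bounded_functional_approx[OF _ _ \<epsilon>])
      show "sandwich_form f (\<lambda>n. \<Sum>i\<in>I. k i * h i n) s
          - (\<Sum>s'\<in>T. coeff_inner (\<lambda>n. \<Sum>i\<in>I. k i * h i n) s' * sandwich_form f s' s)
        = (\<Sum>i\<in>I. k i * (sandwich_form f (h i) s - (\<Sum>s'\<in>T. coeff_inner (h i) s' * sandwich_form f s' s)))"
        if I: "finite I" "\<And>i. i \<in> I \<Longrightarrow> finsupp (h i)" for I :: "('d \<Rightarrow> int) set" and k h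
      proof -
        have "(\<Sum>s'\<in>T. coeff_inner (\<lambda>n. \<Sum>i\<in>I. k i * h i n) s' * sandwich_form f s' s)
           = (\<Sum>i\<in>I. k i * (\<Sum>s'\<in>T. coeff_inner (h i) s' * sandwich_form f s' s))"
        proof -
          have "coeff_inner (\<lambda>n. \<Sum>i\<in>I. k i * h i n) s' = (\<Sum>i\<in>I. k i * coeff_inner (h i) s')" for s'
            by (rule coeff_inner_sum_left[OF I])
          then show ?thesis
            by (simp only: sum_distrib_left sum_distrib_right mult.assoc) (rule sum.swap)
        qed
        then show ?thesis
          by (simp add: sandwich_form_sum_left[OF f I] right_diff_distrib sum_subtractf)
      qed
      show "cmod (sandwich_form f c s - (\<Sum>s'\<in>T. coeff_inner c s' * sandwich_form f s' s)) \<le> r * K"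
        if "finsupp c" "coeff_normsq c \<le> 1" for c
        using bound[OF fQ[OF that(1)] nQ[OF that] fT[OF s]] nT[OF s] form_Q_left[OF that(1), of s] by simp
    qed
    then have "\<forall>s\<in>T. \<exists>a. rep (\<lambda>c. sandwich_form f c s - (\<Sum>s'\<in>T. coeff_inner c s' * sandwich_form f s' s)) a"
      by (rule ballI)
    from bchoice[OF this] obtain \<alpha> where
      "\<forall>s\<in>T. rep (\<lambda>c. sandwich_form f c s - (\<Sum>s'\<in>T. coeff_inner c s' * sandwich_form f s' s)) (\<alpha> s)"
      by (elim exE)
    then have \<alpha>: "finsupp (\<alpha> s)" "finsupp c \<Longrightarrow> coeff_normsq c \<le> 1 \<Longrightarrow>
        cmod ((sandwich_form f c s - (\<Sum>s'\<in>T. coeff_inner c s' * sandwich_form f s' s)) - coeff_inner c (\<alpha> s)) \<le> \<epsilon>"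
      if "s \<in> T" for s c
      using that by (simp_all add: rep_def)
    \<comment> \<open>The left copy of \<open>T\<close> carries the terms that project the first
      argument, the right copy those that project the second.\<close>
    define A where "A = case_sum id \<alpha>"
    define B where "B = case_sum \<beta> id"
    have "sandwich_sing_val f k \<le> ereal (5 * r / t + \<eta>)"
    proof (rule sandwich_sing_val_le[where I = "T <+> T" and A = A and B = B])
      show "finite (T <+> T)" using T by simp
      \<comment> \<open>The strict inequality against \<open>k + 1\<close> gives
        \<open>2 * card T \<le> k\<close> by integrality.\<close>
      have "real (2 * card T) < real k + 1" using T(3) k by simp
      then show "card (T <+> T) \<le> k" using T by (simp add: card_Plus)
      show "finsupp (A i)" "finsupp (B i)" if "i \<in> T <+> T" for i
        using that fT \<alpha>(1) \<beta>(1) by (auto simp: A_def B_def)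
      fix c c' :: "('d \<Rightarrow> int) \<Rightarrow> complex"
      assume c: "finsupp c" and c': "finsupp c'" and nc: "coeff_normsq c \<le> 1" and nc': "coeff_normsq c' \<le> 1"
      have inner_le: "cmod (coeff_inner d s) \<le> 1" if "finsupp d" "coeff_normsq d \<le> 1" "s \<in> T" for d s
      proof -
        have "(cmod (coeff_inner d s))\<^sup>2 \<le> (\<Sum>s\<in>T. (cmod (coeff_inner d s))\<^sup>2)"
          using that T by (intro member_le_sum) auto
        also have "\<dots> \<le> 1" using coeff_bessel[OF T(1,2) that(1)] that(2) by linarith
        finally show ?thesis by (simp add: power_le_one_iff)
      qed
      \<comment> \<open>First \<open>c\<close> is replaced by its residual, then \<open>c'\<close>
        in the form that results; hence \<open>Q c\<close> in the last sum.\<close>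
      have split: "sandwich_form f c c' = sandwich_form f (Q c) (Q c')
          + (\<Sum>s\<in>T. coeff_inner c s * sandwich_form f s c')
          + (\<Sum>s\<in>T. cnj (coeff_inner c' s) * sandwich_form f (Q c) s)"
        using form_Q_left[OF c, of c'] form_Q_right[OF c', of "Q c"] by simp
      have "(\<Sum>i\<in>T <+> T. coeff_inner c (A i) * coeff_inner (B i) c')
        = (\<Sum>s\<in>T. coeff_inner c s * coeff_inner (\<beta> s) c') + (\<Sum>s\<in>T. cnj (coeff_inner c' s) * coeff_inner c (\<alpha> s))"
        using T coeff_inner_commute[OF c' fT] by (simp add: sum.Plus A_def B_def mult.commute)
      then have "sandwich_form f c c' - (\<Sum>i\<in>T <+> T. coeff_inner c (A i) * coeff_inner (B i) c')
        = sandwich_form f (Q c) (Q c')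
          + (\<Sum>s\<in>T. coeff_inner c s * (sandwich_form f s c' - coeff_inner (\<beta> s) c'))
          + (\<Sum>s\<in>T. cnj (coeff_inner c' s) * (sandwich_form f (Q c) s - coeff_inner c (\<alpha> s)))"
        by (simp add: split right_diff_distrib sum_subtractf)
      also have "cmod \<dots> \<le> 5 * r / t + card T * \<epsilon> + card T * \<epsilon>"
      proof (intro norm_triangle_mono)
        have "cmod (sandwich_form f (Q c) (Q c')) \<le> r / 2 * (energy (Q c) + energy (Q c'))"
          by (rule sandwich_form_le[OF f fw r])
        also have "\<dots> \<le> r / 2 * (5 / t + 5 / t)"
          using Q_small[OF c nc] Q_small[OF c' nc'] r by (intro mult_left_mono add_mono) auto
        finally show "cmod (sandwich_form f (Q c) (Q c')) \<le> 5 * r / t" by (simp add: mult.commute)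
        show "cmod (\<Sum>s\<in>T. coeff_inner c s * (sandwich_form f s c' - coeff_inner (\<beta> s) c')) \<le> card T * \<epsilon>"
        proof (rule sum_norm_bound)
          fix s assume s: "s \<in> T"
          have "cmod (sandwich_form f s c' - coeff_inner (\<beta> s) c') = cmod (cnj (sandwich_form f s c' - coeff_inner (\<beta> s) c'))"
            by (rule complex_mod_cnj[symmetric])
          also have "\<dots> = cmod (cnj (sandwich_form f s c') - coeff_inner c' (\<beta> s))"
            using coeff_inner_commute[OF \<beta>(1)[OF s] c'] by simp
          also have "\<dots> \<le> \<epsilon>" by (rule \<beta>(2)[OF s c' nc'])
          finally have "cmod (coeff_inner c s) * cmod (sandwich_form f s c' - coeff_inner (\<beta> s) c') \<le> 1 * \<epsilon>"
            using inner_le[OF c nc s] by (intro mult_mono) auto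
          then show "cmod (coeff_inner c s * (sandwich_form f s c' - coeff_inner (\<beta> s) c')) \<le> \<epsilon>"
            by (simp add: norm_mult)
        qed
        show "cmod (\<Sum>s\<in>T. cnj (coeff_inner c' s) * (sandwich_form f (Q c) s - coeff_inner c (\<alpha> s))) \<le> card T * \<epsilon>"
        proof (rule sum_norm_bound)
          fix s assume s: "s \<in> T"
          have "cmod (sandwich_form f (Q c) s - coeff_inner c (\<alpha> s)) \<le> \<epsilon>"
            using \<alpha>(2)[OF s c nc] by (simp add: form_Q_left[OF c])
          then have "cmod (coeff_inner c' s) * cmod (sandwich_form f (Q c) s - coeff_inner c (\<alpha> s)) \<le> 1 * \<epsilon>"
            using inner_le[OF c' nc' s] by (intro mult_mono) auto
          then show "cmod (cnj (coeff_inner c' s) * (sandwich_form f (Q c) s - coeff_inner c (\<alpha> s))) \<le> \<epsilon>"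
            by (simp add: norm_mult)
        qed
      qed
      also have "\<dots> \<le> 5 * r / t + \<eta>"
      proof -
        have "2 * real (card T) + 1 \<noteq> 0" by linarith
        then have "(2 * real (card T) + 1) * \<epsilon> = \<eta>"
          unfolding \<epsilon>_def times_divide_eq_right by (rule nonzero_mult_div_cancel_left)
        then show ?thesis using \<epsilon> by (simp add: algebra_simps)
      qed
      finally show "cmod (sandwich_form f c c' - (\<Sum>i\<in>T <+> T. coeff_inner c (A i) * coeff_inner (B i) c')) \<le> 5 * r / t + \<eta>" .
    qed
    then show ?thesis by simp
  qed
  then show ?thesis by (rule ereal_le_epsilon2)
qed

section \<open>From admissible scales to the Orlicz norm\<close>

theorem theorem1p1:
  "\<exists>c::real. \<forall>f :: real^'d \<Rightarrow> complex.
     f \<in> orlicz_space M_LlogL (torus_measure::(real^'d) measure) \<longrightarrow>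
     sandwich_weak_L1_norm f \<le> ereal (c * orlicz_norm M_LlogL (torus_measure::(real^'d) measure) f)"
proof (intro exI allI impI)
  fix f :: "real^'d \<Rightarrow> complex"
  assume f: "f \<in> orlicz_space M_LlogL (torus_measure::(real^'d) measure)"
  define C :: real where "C = 5 * (52 * 3 ^ CARD('d))"
  define S where "S = {r. r > 0 \<and> (\<integral>\<^sup>+ x. ennreal (M_LlogL (cmod (f x) / r)) \<partial>torus_measure) \<le> 1}"
  have f_meas [measurable]: "f \<in> borel_measurable borel"
    using f by (simp add: orlicz_space_def measurable_cong_sets[OF sets_torus_measure refl])
  have weak: "sandwich_weak_L1_norm f \<le> ereal (C * r)" if r: "r \<in> S" for r
    unfolding sandwich_weak_L1_norm_def
  proof (rule SUP_least)
    fix k :: nat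
    have r0: "r > 0" using r by (simp add: S_def)
    \<comment> \<open>The factor 52 is twice 26: it makes \<open>26 * 3 ^ CARD('d) * t\<close> half
      of \<open>k + 1\<close>, hence strictly smaller, and \<open>5 * r / t\<close> becomes
      \<open>C * r / (k + 1)\<close>.\<close>
    define t where "t = (real k + 1) / (52 * 3 ^ CARD('d))"
    have t: "t > 0" by (simp add: t_def)
    interpret normalized_weight "\<lambda>x. cmod (f x) / r"
      by standard (use r in \<open>auto simp: S_def\<close>)
    have "26 * 3 ^ CARD('d) * t = (real k + 1) / 2" by (simp add: t_def)
    also have "\<dots> < real k + 1" by simp
    finally have "26 * 3 ^ CARD('d) * t < real k + 1" .
    then have "sandwich_sing_val f k \<le> ereal (5 * r / t)"
      using r0 by (intro sandwich_sing_val_weight_le f_meas t) simp_all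
    then have "ereal (real k + 1) * sandwich_sing_val f k \<le> ereal (real k + 1) * ereal (5 * r / t)"
      by (intro ereal_mult_left_mono) auto
    also have "\<dots> = ereal (C * r)" by (simp add: t_def C_def field_simps)
    finally show "ereal (real k + 1) * sandwich_sing_val f k \<le> ereal (C * r)" .
  qed
  obtain q where q: "q > 0" "(\<integral>\<^sup>+ x. ennreal (M_LlogL (q * cmod (f x))) \<partial>torus_measure) < \<infinity>"
    using f by (auto simp: orlicz_space_def)
  define I where "I = enn2real (\<integral>\<^sup>+ x. ennreal (M_LlogL (q * cmod (f x))) \<partial>(torus_measure :: (real^'d) measure))"
  have I: "(\<integral>\<^sup>+ x. ennreal (M_LlogL (q * cmod (f x))) \<partial>(torus_measure :: (real^'d) measure)) = ennreal I" "I \<ge> 0"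
    using q by (auto simp: I_def)
  \<comment> \<open>Scaling by \<open>s\<close> brings the finite modular \<open>I\<close> down to
    at most 1, so \<open>1 / (s * q)\<close> is an admissible scale and \<open>Inf S\<close> is
    taken over a nonempty set.\<close>
  define s where "s = 1 / (I + 1)"
  have s: "0 < s" "s \<le> 1" "s * I \<le> 1" using I by (auto simp: s_def field_simps)
  have "(\<integral>\<^sup>+ x. ennreal (M_LlogL (cmod (f x) / (1 / (s * q)))) \<partial>torus_measure)
      \<le> (\<integral>\<^sup>+ x. ennreal s * ennreal (M_LlogL (q * cmod (f x))) \<partial>(torus_measure :: (real^'d) measure))"
  proof (rule nn_integral_mono)
    fix x
    have "M_LlogL (s * (q * cmod (f x))) \<le> s * M_LlogL (q * cmod (f x))"
      using s q by (intro M_LlogL_scale_le) auto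
    then show "ennreal (M_LlogL (cmod (f x) / (1 / (s * q)))) \<le> ennreal s * ennreal (M_LlogL (q * cmod (f x)))"
      using s by (simp add: ennreal_mult'[symmetric] ennreal_leI mult_ac)
  qed
  also have "\<dots> = ennreal s * ennreal I"
    unfolding I(1)[symmetric]
    by (rule nn_integral_cmult) (unfold M_LlogL_def, measurable)
  also have "\<dots> \<le> 1" using s I by (simp add: ennreal_mult'[symmetric])
  finally have S: "1 / (s * q) \<in> S" using s q by (simp add: S_def)
  have norm: "orlicz_norm M_LlogL (torus_measure::(real^'d) measure) f = Inf S"
    by (simp add: orlicz_norm_def S_def)
  have C: "C > 0" by (simp add: C_def)
  show "sandwich_weak_L1_norm f \<le> ereal (C * orlicz_norm M_LlogL (torus_measure::(real^'d) measure) f)"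
  proof (rule ereal_le_epsilon2)
    fix e :: real assume e: "e > 0"
    \<comment> \<open>An admissible scale within \<open>e / C\<close> of the infimum is enough, so
      attainment need not be shown.\<close>
    have "Inf S < Inf S + e / C" using e C by simp
    then obtain r where r: "r \<in> S" "r < Inf S + e / C"
      using S cInf_lessD[of S "Inf S + e / C"] by blast
    have "C * r \<le> C * (Inf S + e / C)" using r C by (intro mult_left_mono) auto
    also have "\<dots> = C * Inf S + e" using C by (simp add: algebra_simps)
    finally have "C * r \<le> C * Inf S + e" .
    then have "ereal (C * r) \<le> ereal (C * Inf S) + ereal e" by simp
    then show "sandwich_weak_L1_norm f \<le> ereal (C * orlicz_norm M_LlogL (torus_measure::(real^'d) measure) f) + ereal e"
      using weak[OF r(1)] unfolding norm by (rule order_trans[rotated])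
  qed
qed

end
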